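(* Let $\varphi(x)=Ax^2+Bx+C \in \mathbb{Z}[x]$ be a fixed quadratic polynomial with $A \neq 0$. For every odd prime $p\nmid A$, $$\left|f_\varphi(p)-\frac{(p-1)^2}{4p}\right|\leq\frac{4}{\pi^2}\left(7.0508\sqrt{p}+2\right)\log(3p).$$ In particular, as $p$ ranges over all odd primes, $$f_\varphi(p)=\frac{p}{4}+O_\varphi(\sqrt{p}\log p).$$
   Context: For $\varphi\in\mathbb Z[x]$ and an odd prime $p$, $$f_\varphi(p) := \#\left\{k\in\mathbb Z : 1 \le k < \tfrac{p}{2},\ \left\{\tfrac{\varphi(k)}{p}\right\} > \tfrac{1}{2}\right\},$$ where $\{t\}$ denotes the fractional part of a real number $t$. Here $\log$ is the natural logarithm. $F = O_\varphi(G)$ means $|F|\le cG$ for a constant $c>0$ depending only on $\varphi$ (its degree and coefficients), not on $p$. *)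

theory Defs
  imports "HOL-Analysis.Analysis" "HOL-Computational_Algebra.Polynomial" "HOL-Computational_Algebra.Primes"
begin

definition f_count :: "int poly \<Rightarrow> nat \<Rightarrow> nat" where
  "f_count \<phi> p = card {k::int. 1 \<le> k \<and> real_of_int k < real p / 2 \<and>
     frac (real_of_int (poly \<phi> k) / real p) > 1 / 2}"

end

theory Submission
  imports Defs "HOL-Probability.Characteristic_Functions" "HOL-Complex_Analysis.Residue_Theorem"
begin

text \<open>
  Let \<open>H = (p - 1) / 2\<close>.  The quantity counted is the number of \<open>k = 1, ..., H\<close> for which \<open>\<phi>(k) mod p\<close> lies
  in the interval \<open>{H + 1..p - 1}\<close>, which has \<open>H\<close> elements.  Expanding the indicator function of this
  interval in additive characters mod \<open>p\<close>, the frequency \<open>0\<close> gives exactly \<open>H\<^sup>2 / p = (p - 1)\<^sup>2 / (4 p)\<close>,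
  and the error is at most
  \<open>(1 / p) \<Sum>b=1..p-1. \<bar>D b\<bar> \<bar>E b\<bar>\<close>, where \<open>D b\<close> is a geometric sum of length \<open>H\<close> and
  \<open>E b = \<Sum>k=1..H. e(b \<phi>(k) / p)\<close> is an incomplete quadratic Gauss sum (\<open>e(x)\<close> stands for \<open>cis (2 \<pi> x)\<close>).
  The geometric sums contribute one logarithm: \<open>(1 / p) \<Sum> \<bar>D b\<bar> \<le> (2 / \<pi>) (1 + ln p / 2) + 1 / 2\<close>,
  because \<open>D b\<close> is of size \<open>p / b\<close> for odd \<open>b\<close> near \<open>0\<close> but bounded for even \<open>b\<close> near \<open>0\<close>
  (lemma \<open>sum_norm_interval_sum_le\<close>).

  No second logarithm may be lost, so the Gauss sums need the bound \<open>7 \<surd>p - 5\<close> without a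
  logarithm (lemma \<open>incomplete_gauss_sum_bound\<close>).  It comes from a reciprocity law: for \<open>0 < \<alpha>\<close>, the norm
  of a sum \<open>\<Sum>n<N. e(\<alpha> n\<^sup>2 / 2 + z n)\<close> is at most \<open>(\<surd>2 + \<bar>S\<bar>) / \<surd>\<alpha>\<close>, where \<open>S\<close> is a sum of the same shape
  with parameter \<open>1 / \<alpha>\<close>, another \<open>z\<close> and a length of at most \<open>N \<alpha> + 1\<close>
  (lemma \<open>quadratic_sum_reciprocity_step\<close>).  For \<open>\<alpha> = r / q\<close> with \<open>r \<le> q / 2\<close> the denominator drops from \<open>q\<close>
  to \<open>r\<close>, so the errors along this nearest-integer continued fraction grow geometrically and add up
  to \<open>O(\<surd>q)\<close>.

  Reciprocity in turn is read off from the integral of Mordell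
  \<open>h(z) = \<integral> exp (\<pi> \<i> \<alpha> x\<^sup>2 - 2 \<pi> z x) / cosh (\<pi> x) dx\<close>.
  It satisfies two difference equations: \<open>h(z) + h(z + 1)\<close> is a Gaussian integral, and
  \<open>h(z) + e(- z - \<alpha> / 2) h(z + \<alpha>)\<close> is a residue at \<open>\<i> / 2\<close>, obtained by moving the line of integration by \<open>\<i>\<close>.
  Iterating the second one \<open>N\<close> times produces the sum with parameter \<open>\<alpha>\<close>; iterating the first one
  brings the argument \<open>z + N \<alpha>\<close> back to \<open>[-1/2, 1/2]\<close> and produces the sum with parameter \<open>1 / \<alpha>\<close>.  The error
  consists of two values of \<open>h\<close> on \<open>[-1/2, 1/2]\<close>, where \<open>\<bar>h\<bar> \<le> \<surd>2 / \<surd>\<alpha>\<close>.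

  The resulting estimate beats the claimed one as soon as \<open>ln p \<ge> 9\<close>; for smaller \<open>p\<close> the trivial bound
  \<open>p / 4\<close> for the error is good enough.
\<close>

section \<open>Gaussian integrals\<close>

lemma gaussian_integral:
  fixes \<beta> :: real
  assumes "\<beta> > 0"
  shows "integrable lborel (\<lambda>t. exp (- \<beta> * t\<^sup>2))"
    and "(\<integral>t. exp (- \<beta> * t\<^sup>2) \<partial>lborel) = sqrt (pi / \<beta>)"
proof -
  define \<sigma> where "\<sigma> = sqrt (1 / (2 * \<beta>))"
  have s: "\<sigma> > 0" "\<sigma>\<^sup>2 = 1 / (2 * \<beta>)" using assms by (auto simp: \<sigma>_def)
  have e: "exp (- \<beta> * t\<^sup>2) = sqrt (pi / \<beta>) * normal_density 0 \<sigma> t" for t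
    using assms by (simp add: normal_density_def s(2) real_sqrt_divide field_simps)
  show "integrable lborel (\<lambda>t. exp (- \<beta> * t\<^sup>2))"
    unfolding e using s(1) by simp
  show "(\<integral>t. exp (- \<beta> * t\<^sup>2) \<partial>lborel) = sqrt (pi / \<beta>)"
    unfolding e using s(1) by simp
qed

text \<open>
  The characteristic function of the normal distribution, after rescaling.
\<close>

lemma gaussian_fourier:
  fixes \<beta> k :: real
  assumes "\<beta> > 0"
  shows "(\<integral>t. complex_of_real (exp (- \<beta> * t\<^sup>2)) * cis (k * t) \<partial>lborel)
           = sqrt (pi / \<beta>) * exp (- k\<^sup>2 / (4 * \<beta>))"
proof -
  define c where "c = sqrt (1 / (2 * \<beta>))"
  have c: "c > 0" "c\<^sup>2 = 1 / (2 * \<beta>)" using assms by (auto simp: c_def)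
  have b: "\<beta> * (c * x)\<^sup>2 = x\<^sup>2 / 2" for x
    using assms by (simp add: power_mult_distrib c(2))
  have "(\<integral>t. complex_of_real (exp (- \<beta> * t\<^sup>2)) * cis (k * t) \<partial>lborel)
      = c *\<^sub>R (\<integral>x. complex_of_real (exp (- \<beta> * (0 + c * x)\<^sup>2)) * cis (k * (0 + c * x)) \<partial>lborel)"
    using lborel_integral_real_affine[of c "\<lambda>t. complex_of_real (exp (- \<beta> * t\<^sup>2)) * cis (k * t)" 0] c(1) by simp
  also have "(\<lambda>x. complex_of_real (exp (- \<beta> * (0 + c * x)\<^sup>2)) * cis (k * (0 + c * x)))
      = (\<lambda>x. sqrt (2 * pi) *\<^sub>R (std_normal_density x *\<^sub>R iexp ((k * c) * x)))"
    unfolding add_0_left minus_mult_left[symmetric] b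
    by (intro ext) (simp add: std_normal_density_def cis_conv_exp scaleR_conv_of_real mult_ac)
  also have "(\<integral>x. sqrt (2 * pi) *\<^sub>R (std_normal_density x *\<^sub>R iexp ((k * c) * x)) \<partial>lborel)
      = sqrt (2 * pi) *\<^sub>R char std_normal_distribution (k * c)"
    unfolding char_def
    by (subst integral_density) (auto simp: normal_density_nonneg simp del: scaleR_scaleR)
  also have "\<dots> = sqrt (2 * pi) *\<^sub>R complex_of_real (exp (- (k * c)\<^sup>2 / 2))"
    by (simp add: char_std_normal_distribution)
  also have "c *\<^sub>R \<dots> = sqrt (pi / \<beta>) * exp (- k\<^sup>2 / (4 * \<beta>))"
  proof -
    have "c * sqrt (2 * pi) = sqrt (pi / \<beta>)"
      using assms by (simp add: c_def real_sqrt_mult[symmetric])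
    moreover have "- (k * c)\<^sup>2 / 2 = - k\<^sup>2 / (4 * \<beta>)"
      using assms by (simp add: power_mult_distrib c(2))
    ultimately show ?thesis
      by (metis of_real_mult scaleR_conv_of_real mult.assoc)
  qed
  finally show ?thesis .
qed

section \<open>The integral of Mordell\<close>

text \<open>
  The direction of steepest descent of \<open>exp (\<pi> \<i> \<alpha> x\<^sup>2)\<close>: along \<open>x = diag * t\<close> this factor is the real Gaussian
  \<open>exp (- \<pi> \<alpha> t\<^sup>2)\<close>.  The line also avoids the poles of \<open>1 / cosh (\<pi> x)\<close>, which lie on the imaginary axis.
\<close>

definition diag :: complex where "diag = cis (pi / 4)"

lemma diag_eq: "diag = Complex (1 / sqrt 2) (1 / sqrt 2)"
  by (simp add: diag_def complex_eq_iff cos_45 sin_45 real_div_sqrt)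

lemma diag_square: "diag\<^sup>2 = \<i>"
  by (simp add: diag_eq complex_eq_iff power2_eq_square)

lemma norm_diag [simp]: "norm diag = 1"
  by (simp add: diag_def)

lemma Re_diag [simp]: "Re diag = 1 / sqrt 2" and Im_diag [simp]: "Im diag = 1 / sqrt 2"
  by (simp_all add: diag_eq)

lemma norm_cosh_complex_square:
  "(norm (cosh z))\<^sup>2 = (cosh (Re z))\<^sup>2 - (sin (Im z))\<^sup>2" for z :: complex
proof -
  have "Re (cosh z) = cosh (Re z) * cos (Im z)"
    by (simp add: cosh_def Re_exp field_simps)
  moreover have "Im (cosh z) = sinh (Re z) * sin (Im z)"
    by (simp add: cosh_def sinh_def Im_exp field_simps)
  ultimately have "(norm (cosh z))\<^sup>2 = (cosh (Re z) * cos (Im z))\<^sup>2 + (sinh (Re z) * sin (Im z))\<^sup>2"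
    by (simp add: cmod_power2)
  also have "\<dots> = (cosh (Re z))\<^sup>2 - (sin (Im z))\<^sup>2"
    by (simp add: power_mult_distrib cos_squared_eq sinh_square_eq algebra_simps)
  finally show ?thesis .
qed

text \<open>
  Since \<open>\<bar>cosh (a + \<i> a)\<bar>\<^sup>2 = cosh\<^sup>2 a - sin\<^sup>2 a\<close>, the claim is \<open>2 sin\<^sup>2 a \<le> cosh\<^sup>2 a = 1 + sinh\<^sup>2 a\<close>, which follows from
  \<open>\<bar>sin a\<bar> \<le> 1\<close> and \<open>\<bar>sin a\<bar> \<le> \<bar>a\<bar> \<le> \<bar>sinh a\<bar>\<close>.
\<close>

lemma cosh_le_norm_cosh_diagonal:
  "cosh a \<le> sqrt 2 * norm (cosh (Complex a a))"
proof (rule power2_le_imp_le)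
  have "(sin a)\<^sup>2 \<le> 1" by (simp add: abs_square_le_1)
  moreover have "(sin a)\<^sup>2 \<le> a\<^sup>2"
    using abs_sin_x_le_abs_x[of a] by (rule abs_le_square_iff[THEN iffD1])
  moreover have "a\<^sup>2 \<le> (sinh a)\<^sup>2"
    using real_le_abs_sinh[of a]
    by (simp add: abs_le_square_iff[symmetric] sinh_field_def exp_minus)
  ultimately show "(cosh a)\<^sup>2 \<le> (sqrt 2 * norm (cosh (Complex a a)))\<^sup>2"
    by (simp add: power_mult_distrib norm_cosh_complex_square cosh_square_eq)
qed simp


definition mordell_kernel :: "real \<Rightarrow> real \<Rightarrow> complex \<Rightarrow> complex" where
  "mordell_kernel \<alpha> z (x :: complex) =
     exp (\<i> * of_real (pi * \<alpha>) * x\<^sup>2 - of_real (2 * pi * z) * x) / cosh (of_real pi * x)"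

text \<open>
  Taking the integral along the diagonal makes it absolutely convergent for every \<open>\<alpha> > 0\<close> and every real \<open>z\<close>;
  along the real axis it would be an oscillatory integral, divergent for \<open>\<bar>z\<bar> > 1 / 2\<close>.
\<close>

definition mordell_integral :: "real \<Rightarrow> real \<Rightarrow> complex" where
  "mordell_integral \<alpha> z = diag * (\<integral>t. mordell_kernel \<alpha> z (diag * of_real t) \<partial>lborel)"

lemma pi_diag: "of_real pi * (diag * of_real t) = Complex (pi * t / sqrt 2) (pi * t / sqrt 2)"
  by (simp add: complex_eq_iff)

lemma cosh_diag_ge_1: "1 \<le> sqrt 2 * norm (cosh (of_real pi * (diag * of_real t)))"
  using cosh_le_norm_cosh_diagonal[of "pi * t / sqrt 2"] cosh_real_ge_1[of "pi * t / sqrt 2"]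
  unfolding pi_diag by linarith

lemma cosh_diag_nonzero [simp]: "cosh (of_real pi * (diag * of_real t)) \<noteq> 0"
  using cosh_diag_ge_1[of t] by auto

lemma mordell_kernel_diag:
  "mordell_kernel \<alpha> z (diag * of_real t) =
     exp (- pi * \<alpha> * t\<^sup>2) * exp (- 2 * pi * z * (diag * t)) / cosh (of_real pi * (diag * of_real t))"
proof -
  have "\<i> * of_real (pi * \<alpha>) * (diag * of_real t)\<^sup>2 = (\<i> * \<i>) * of_real (pi * \<alpha> * t\<^sup>2)"
    by (simp only: power_mult_distrib diag_square of_real_mult of_real_power mult_ac)
  also have "\<dots> = of_real (- pi * \<alpha> * t\<^sup>2)" by simp
  finally have "\<i> * of_real (pi * \<alpha>) * (diag * of_real t)\<^sup>2 = of_real (- pi * \<alpha> * t\<^sup>2)" .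
  then show ?thesis
    by (simp add: mordell_kernel_def exp_add[symmetric] exp_of_real[symmetric])
qed

lemma continuous_mordell_kernel_diag:
  "continuous_on UNIV (\<lambda>t. mordell_kernel \<alpha> z (diag * of_real t))"
  unfolding mordell_kernel_def by (intro continuous_intros) auto

text \<open>
  A majorant for integrability: the denominator is bounded below by a constant and the linear term is left to
  the Gaussian.
\<close>

lemma norm_mordell_kernel_diag_le:
  "norm (mordell_kernel \<alpha> z (diag * of_real t)) \<le> sqrt 2 * exp (sqrt 2 * pi * \<bar>z\<bar> * \<bar>t\<bar> - pi * \<alpha> * t\<^sup>2)"
proof -
  define c where "c = norm (cosh (of_real pi * (diag * of_real t)))"
  have c: "1 \<le> sqrt 2 * c" unfolding c_def by (rule cosh_diag_ge_1)
  then have "0 < sqrt 2 * c" by linarith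
  then have "c > 0" by (simp add: zero_less_mult_iff)
  have "- 2 * pi * z * (t / sqrt 2) = - (sqrt 2 * pi * z * t)"
    by (simp add: field_simps)
  also have "\<dots> \<le> sqrt 2 * pi * \<bar>z\<bar> * \<bar>t\<bar>"
    using abs_ge_minus_self[of "sqrt 2 * pi * z * t"] by (simp add: abs_mult)
  finally have e: "- 2 * pi * z * (t / sqrt 2) \<le> sqrt 2 * pi * \<bar>z\<bar> * \<bar>t\<bar>" .
  have "norm (mordell_kernel \<alpha> z (diag * of_real t)) = exp (- pi * \<alpha> * t\<^sup>2 + - 2 * pi * z * (t / sqrt 2)) / c"
    by (simp add: mordell_kernel_diag norm_mult norm_divide c_def exp_add[symmetric])
  also have "\<dots> \<le> exp (sqrt 2 * pi * \<bar>z\<bar> * \<bar>t\<bar> - pi * \<alpha> * t\<^sup>2) / c"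
    using e \<open>c > 0\<close> by (intro divide_right_mono) auto
  also have "\<dots> \<le> exp (sqrt 2 * pi * \<bar>z\<bar> * \<bar>t\<bar> - pi * \<alpha> * t\<^sup>2) * (sqrt 2)"
    using c \<open>c > 0\<close> by (simp add: field_simps)
  finally show ?thesis by (simp add: mult.commute)
qed

lemma integrable_mordell_kernel_diag:
  assumes "\<alpha> > 0"
  shows "integrable lborel (\<lambda>t. mordell_kernel \<alpha> z (diag * of_real t))"
proof (rule Bochner_Integration.integrable_bound)
  show "integrable lborel (\<lambda>t. sqrt 2 * exp (pi * z\<^sup>2 / \<alpha>) * exp (- (pi * \<alpha> / 2) * t\<^sup>2))"
    using assms by (intro integrable_mult_right gaussian_integral) auto
  show "(\<lambda>t. mordell_kernel \<alpha> z (diag * of_real t)) \<in> borel_measurable lborel"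
    using continuous_mordell_kernel_diag by (simp add: borel_measurable_continuous_onI)
  show "AE t in lborel. norm (mordell_kernel \<alpha> z (diag * of_real t))
          \<le> norm (sqrt 2 * exp (pi * z\<^sup>2 / \<alpha>) * exp (- (pi * \<alpha> / 2) * t\<^sup>2))"
  proof (rule AE_I2)
    fix t :: real
    \<comment> \<open>Completing the square absorbs the linear term into half of the Gaussian.\<close>
    have "0 \<le> (sqrt (\<alpha> / 2) * \<bar>t\<bar> - \<bar>z\<bar> / sqrt \<alpha>)\<^sup>2" by simp
    also have "\<dots> = \<alpha> / 2 * t\<^sup>2 - sqrt 2 * \<bar>z\<bar> * \<bar>t\<bar> + z\<^sup>2 / \<alpha>"
    proof -
      have "(sqrt (\<alpha> / 2) * \<bar>t\<bar>)\<^sup>2 = \<alpha> / 2 * t\<^sup>2" "(\<bar>z\<bar> / sqrt \<alpha>)\<^sup>2 = z\<^sup>2 / \<alpha>"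
        using assms by (simp_all add: power_mult_distrib power_divide)
      moreover have "2 * (sqrt (\<alpha> / 2) * \<bar>t\<bar>) * (\<bar>z\<bar> / sqrt \<alpha>) = sqrt 2 * \<bar>z\<bar> * \<bar>t\<bar>"
        using assms by (simp add: real_sqrt_divide field_simps)
      ultimately show ?thesis by (simp only: power2_diff)
    qed
    finally have "pi * (sqrt 2 * \<bar>z\<bar> * \<bar>t\<bar>) \<le> pi * (\<alpha> / 2 * t\<^sup>2 + z\<^sup>2 / \<alpha>)"
      by (intro mult_left_mono) auto
    then have "sqrt 2 * pi * \<bar>z\<bar> * \<bar>t\<bar> - pi * \<alpha> * t\<^sup>2 \<le> pi * z\<^sup>2 / \<alpha> + - (pi * \<alpha> / 2) * t\<^sup>2"
      by (simp add: algebra_simps)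
    then have "exp (sqrt 2 * pi * \<bar>z\<bar> * \<bar>t\<bar> - pi * \<alpha> * t\<^sup>2) \<le> exp (pi * z\<^sup>2 / \<alpha>) * exp (- (pi * \<alpha> / 2) * t\<^sup>2)"
      by (simp add: exp_add[symmetric])
    then have "sqrt 2 * exp (sqrt 2 * pi * \<bar>z\<bar> * \<bar>t\<bar> - pi * \<alpha> * t\<^sup>2) \<le> sqrt 2 * (exp (pi * z\<^sup>2 / \<alpha>) * exp (- (pi * \<alpha> / 2) * t\<^sup>2))"
      by (intro mult_left_mono) auto
    with norm_mordell_kernel_diag_le[of \<alpha> z t]
    show "norm (mordell_kernel \<alpha> z (diag * of_real t))
          \<le> norm (sqrt 2 * exp (pi * z\<^sup>2 / \<alpha>) * exp (- (pi * \<alpha> / 2) * t\<^sup>2))"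
      by (simp only: norm_mult real_norm_def abs_exp_cancel abs_of_nonneg real_sqrt_ge_zero mult.assoc)
  qed
qed

text \<open>
  Averaging the integrand over \<open>t\<close> and \<open>-t\<close> turns the exponential into \<open>cosh (2 \<pi> z x)\<close>.  For \<open>\<bar>z\<bar> \<le> 1 / 2\<close> its norm is at
  most \<open>cosh a\<close>, where \<open>a\<close> is the real part of \<open>\<pi> x\<close>, and this exceeds the norm of the denominator by at most
  the factor \<open>\<surd>2\<close>.  What remains is a Gaussian integral.
\<close>

lemma norm_mordell_integral_le:
  assumes "\<alpha> > 0" "\<bar>z\<bar> \<le> 1 / 2"
  shows "norm (mordell_integral \<alpha> z) \<le> sqrt 2 / sqrt \<alpha>"
proof -
  define g where "g t = mordell_kernel \<alpha> z (diag * of_real t)" for t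
  have g: "integrable lborel g" unfolding g_def by (rule integrable_mordell_kernel_diag[OF assms(1)])
  have g': "integrable lborel (\<lambda>t. g (- t))"
    using g lborel_integrable_real_affine[of g "-1" 0] by simp
  have "(\<integral>t. g t \<partial>lborel) = (\<integral>t. g (- t) \<partial>lborel)"
    using lborel_integral_real_affine[of "-1" g 0] by simp
  then have symm: "(\<integral>t. g t \<partial>lborel) = (\<integral>t. (g t + g (- t)) / 2 \<partial>lborel)"
    using g g' by simp
  have le: "norm ((g t + g (- t)) / 2) \<le> sqrt 2 * exp (- (pi * \<alpha>) * t\<^sup>2)" for t
  proof -
    define a where "a = pi * t / sqrt 2"
    define c where "c = norm (cosh (of_real pi * (diag * of_real t)))"
    have c: "cosh a \<le> sqrt 2 * c" 
      unfolding c_def a_def pi_diag by (rule cosh_le_norm_cosh_diagonal)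
    then have "0 < sqrt 2 * c" using cosh_real_ge_1[of a] by linarith
    then have "c > 0" by (simp add: zero_less_mult_iff)
    have "g (- t) = exp (- pi * \<alpha> * t\<^sup>2) * exp (2 * pi * z * (diag * t)) / cosh (of_real pi * (diag * of_real t))"
      unfolding g_def using mordell_kernel_diag[of \<alpha> z "- t"] by simp
    then have "g t + g (- t) = exp (- pi * \<alpha> * t\<^sup>2) * (exp (- 2 * pi * z * (diag * t)) + exp (2 * pi * z * (diag * t)))
          / cosh (of_real pi * (diag * of_real t))"
      by (simp add: g_def mordell_kernel_diag add_divide_distrib distrib_left)
    also have "norm \<dots> = exp (- pi * \<alpha> * t\<^sup>2) * norm (exp (- 2 * pi * z * (diag * t)) + exp (2 * pi * z * (diag * t))) / c"
      by (simp add: norm_mult norm_divide c_def)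
    also have "\<dots> \<le> exp (- pi * \<alpha> * t\<^sup>2) * (2 * cosh (2 * z * a)) / c"
    proof (intro divide_right_mono mult_left_mono)
      have "norm (exp (- 2 * pi * z * (diag * t)) + exp (2 * pi * z * (diag * t)))
         \<le> norm (exp (- 2 * pi * z * (diag * t))) + norm (exp (2 * pi * z * (diag * t)))"
        by (rule norm_triangle_ineq)
      also have "\<dots> = 2 * cosh (2 * z * a)"
        by (simp add: cosh_field_def a_def mult_ac)
      finally show "norm (exp (- 2 * pi * z * (diag * t)) + exp (2 * pi * z * (diag * t))) \<le> 2 * cosh (2 * z * a)" .
    qed (use \<open>c > 0\<close> in auto)
    also have "\<dots> \<le> exp (- pi * \<alpha> * t\<^sup>2) * (2 * (sqrt 2 * c)) / c"
    proof (intro divide_right_mono mult_left_mono)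
      have "\<bar>2 * z * a\<bar> \<le> \<bar>a\<bar>"
        using assms(2) mult_right_mono[of "\<bar>2 * z\<bar>" 1 "\<bar>a\<bar>"] by (simp add: abs_mult)
      then have "cosh \<bar>2 * z * a\<bar> \<le> cosh \<bar>a\<bar>"
        by (subst cosh_real_nonneg_le_iff) auto
      then show "cosh (2 * z * a) \<le> sqrt 2 * c" using c by simp
    qed (use \<open>c > 0\<close> in auto)
    finally show ?thesis using \<open>c > 0\<close> by (simp add: norm_divide mult_ac)
  qed
  have "norm (\<integral>t. g t \<partial>lborel) \<le> (\<integral>t. sqrt 2 * exp (- (pi * \<alpha>) * t\<^sup>2) \<partial>lborel)"
    unfolding symm
  proof (rule order_trans[OF integral_norm_bound integral_mono])
    show "integrable lborel (\<lambda>t. norm ((g t + g (- t)) / 2))" using g g' by simp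
    show "integrable lborel (\<lambda>t. sqrt 2 * exp (- (pi * \<alpha>) * t\<^sup>2))"
      using assms(1) by (intro integrable_mult_right gaussian_integral) simp
  qed (rule le)
  also have "\<dots> = sqrt 2 * sqrt (pi / (pi * \<alpha>))"
    using assms(1) gaussian_integral(2)[of "pi * \<alpha>"] by (simp only: integral_mult_right_zero) simp
  also have "\<dots> = sqrt 2 / sqrt \<alpha>" by (simp add: real_sqrt_divide)
  finally show ?thesis by (simp add: mordell_integral_def norm_mult g_def)
qed

text \<open>
  The sum of the two exponentials in the integrands cancels the denominator \<open>cosh (\<pi> x)\<close> and leaves a Gaussian
  integral with a linear term \<open>-2 \<pi> (z + 1/2) x\<close>.  On the diagonal this term has equal real and imaginary part:
  a real translation by \<open>b\<close> removes the real part, and the imaginary part gives a Fourier transform of a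
  Gaussian.
\<close>

lemma mordell_integral_shift_1:
  assumes "\<alpha> > 0"
  shows "mordell_integral \<alpha> z + mordell_integral \<alpha> (z + 1)
       = 2 * diag / sqrt \<alpha> * cis (pi * (z + 1 / 2)\<^sup>2 / \<alpha>)"
proof -
  define s where "s = z + 1 / 2"
  have "mordell_kernel \<alpha> z (diag * t) + mordell_kernel \<alpha> (z + 1) (diag * t)
          = 2 * (exp (- pi * \<alpha> * t\<^sup>2) * exp (- 2 * pi * s * (diag * t)))" for t :: real
  proof -
    define x where "x = diag * complex_of_real t"
    have "exp (- 2 * pi * z * x) = exp (- 2 * pi * s * x) * exp (pi * x)"
      "exp (- 2 * pi * (z + 1) * x) = exp (- 2 * pi * s * x) * exp (- (pi * x))"
      by (simp_all add: s_def exp_add[symmetric] algebra_simps)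
    then have "exp (- 2 * pi * z * x) + exp (- 2 * pi * (z + 1) * x) = 2 * exp (- 2 * pi * s * x) * cosh (pi * x)"
      by (simp only: cosh_field_def) (simp add: field_simps)
    moreover have "cosh (pi * x) \<noteq> 0" unfolding x_def by simp
    ultimately show ?thesis
      unfolding mordell_kernel_diag
      unfolding x_def[symmetric] add_divide_distrib[symmetric] distrib_left[symmetric]
      by simp
  qed
  moreover have "(\<integral>t. exp (- pi * \<alpha> * t\<^sup>2) * exp (- 2 * pi * s * (diag * t)) \<partial>lborel) = cis (pi * s\<^sup>2 / \<alpha>) / sqrt \<alpha>"
  proof -
    define b where "b = s / (sqrt 2 * \<alpha>)"
    define k where "k = - sqrt 2 * pi * s"
    have "exp (- pi * \<alpha> * (- b + 1 * u)\<^sup>2) * exp (- 2 * pi * s * (diag * complex_of_real (- b + 1 * u)))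
        = (exp (pi * s\<^sup>2 / (2 * \<alpha>)) * cis (pi * s\<^sup>2 / \<alpha>)) * (exp (- (pi * \<alpha>) * u\<^sup>2) * cis (k * u))" for u :: real
    proof -
      have b: "2 * \<alpha> * b = sqrt 2 * s"
        using assms by (simp add: b_def field_simps)
      have b2: "\<alpha> * b\<^sup>2 = s\<^sup>2 / (2 * \<alpha>)"
        using assms by (simp add: b_def power_divide power_mult_distrib power2_eq_square)
      have b3: "sqrt 2 * s * b = s\<^sup>2 / \<alpha>"
        using assms by (simp add: b_def power2_eq_square)
      have half: "2 * pi * s * (v / sqrt 2) = sqrt 2 * pi * s * v" for v
        by (simp add: field_simps)
      have "- pi * \<alpha> * (u - b)\<^sup>2 + - (2 * pi * s * ((u - b) / sqrt 2))
          = - (pi * \<alpha>) * u\<^sup>2 + pi * (2 * \<alpha> * b) * u - pi * (\<alpha> * b\<^sup>2) - sqrt 2 * pi * s * u + pi * (sqrt 2 * s * b)"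
        unfolding half by (simp add: power2_diff algebra_simps)
      also have "\<dots> = pi * s\<^sup>2 / (2 * \<alpha>) + - (pi * \<alpha>) * u\<^sup>2"
        unfolding b b2 b3 using assms by (simp add: field_simps)
      finally have r: "- pi * \<alpha> * (u - b)\<^sup>2 + - (2 * pi * s * ((u - b) / sqrt 2)) = pi * s\<^sup>2 / (2 * \<alpha>) + - (pi * \<alpha>) * u\<^sup>2" .
      have "- (2 * pi * s * ((u - b) / sqrt 2)) = pi * (sqrt 2 * s * b) - sqrt 2 * pi * s * u"
        unfolding half by (simp add: algebra_simps)
      also have "\<dots> = pi * s\<^sup>2 / \<alpha> + k * u"
        unfolding b3 by (simp add: k_def)
      finally have i: "- (2 * pi * s * ((u - b) / sqrt 2)) = pi * s\<^sup>2 / \<alpha> + k * u" .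
      have "exp (- 2 * pi * s * (diag * complex_of_real (u - b)))
          = exp (- (2 * pi * s * ((u - b) / sqrt 2))) * cis (- (2 * pi * s * ((u - b) / sqrt 2)))"
        by (simp add: exp_eq_polar)
      then have "exp (- pi * \<alpha> * (u - b)\<^sup>2) * exp (- 2 * pi * s * (diag * complex_of_real (u - b)))
          = exp (- pi * \<alpha> * (u - b)\<^sup>2 + - (2 * pi * s * ((u - b) / sqrt 2))) * cis (- (2 * pi * s * ((u - b) / sqrt 2)))"
        by (simp only: exp_add of_real_mult mult.assoc)
      also have "\<dots> = (exp (pi * s\<^sup>2 / (2 * \<alpha>)) * cis (pi * s\<^sup>2 / \<alpha>)) * (exp (- (pi * \<alpha>) * u\<^sup>2) * cis (k * u))"
        unfolding r unfolding i exp_add cis_mult[symmetric] by (simp only: of_real_mult mult_ac)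
      finally show ?thesis by simp
    qed
    then have "(\<integral>t. exp (- pi * \<alpha> * t\<^sup>2) * exp (- 2 * pi * s * (diag * t)) \<partial>lborel) =
       (exp (pi * s\<^sup>2 / (2 * \<alpha>)) * cis (pi * s\<^sup>2 / \<alpha>)) * (\<integral>u. complex_of_real (exp (- (pi * \<alpha>) * u\<^sup>2)) * cis (k * u) \<partial>lborel)"
      using lborel_integral_real_affine[of 1 "\<lambda>t. exp (- pi * \<alpha> * t\<^sup>2) * exp (- 2 * pi * s * (diag * t))" "- b"]
      by (simp only: integral_mult_right_zero) simp
    also have "\<dots> = (exp (pi * s\<^sup>2 / (2 * \<alpha>)) * cis (pi * s\<^sup>2 / \<alpha>)) * (sqrt (pi / (pi * \<alpha>)) * exp (- k\<^sup>2 / (4 * (pi * \<alpha>))))"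
      using assms by (subst gaussian_fourier) auto
    also have "- k\<^sup>2 / (4 * (pi * \<alpha>)) = - (pi * s\<^sup>2 / (2 * \<alpha>))"
      using assms by (simp add: k_def power_mult_distrib field_simps power2_eq_square)
    also have "(exp (pi * s\<^sup>2 / (2 * \<alpha>)) * cis (pi * s\<^sup>2 / \<alpha>)) * (sqrt (pi / (pi * \<alpha>)) * exp (- (pi * s\<^sup>2 / (2 * \<alpha>))))
       = (exp (pi * s\<^sup>2 / (2 * \<alpha>)) * exp (- (pi * s\<^sup>2 / (2 * \<alpha>)))) * (cis (pi * s\<^sup>2 / \<alpha>) * sqrt (pi / (pi * \<alpha>)))"
      by (simp only: of_real_mult mult_ac)
    also have "\<dots> = cis (pi * s\<^sup>2 / \<alpha>) / sqrt \<alpha>"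
      by (simp add: exp_add[symmetric] of_real_mult[symmetric] real_sqrt_divide del: of_real_mult)
    finally show ?thesis .
  qed
  ultimately show ?thesis
    unfolding mordell_integral_def distrib_left[symmetric]
    using assms by (simp add: Bochner_Integration.integral_add[symmetric] integrable_mordell_kernel_diag s_def
       del: Bochner_Integration.integral_add)
qed

section \<open>Shifting the contour\<close>

lemma has_contour_integral_affine_linepath:
  fixes c d :: complex and a b :: real
  assumes "a < b"
  shows "(f has_contour_integral I) (linepath (d * a + c) (d * b + c)) \<longleftrightarrow>
         ((\<lambda>t. d * f (d * of_real t + c)) has_integral I) {a..b}"
proof -
  have eq: "linepath (d * a + c) (d * b + c) x = d * linepath (of_real a) (of_real b) x + c" for x
    by (simp add: linepath_def algebra_simps scaleR_conv_of_real)
  have "(f has_contour_integral I) (linepath (d * a + c) (d * b + c)) \<longleftrightarrow>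
     ((\<lambda>w. d * f (d * w + c)) has_contour_integral I) (linepath (of_real a) (of_real b))"
    unfolding has_contour_integral_linepath eq
    by (intro has_integral_cong) (simp add: algebra_simps)
  also have "\<dots> \<longleftrightarrow> ((\<lambda>t. d * f (d * of_real t + c)) has_integral I) {a..b}"
    using assms by (subst has_contour_integral_linepath_Reals_iff) auto
  finally show ?thesis .
qed

lemma integral_symmetric_interval_tendsto:
  fixes f :: "real \<Rightarrow> complex"
  assumes "integrable lborel f"
  shows "(\<lambda>n. integral {- real n..real n} f) \<longlonglongrightarrow> (\<integral>t. f t \<partial>lborel)"
proof -
  have "(\<lambda>n. \<integral>t. indicator {- real n..real n} t *\<^sub>R f t \<partial>lborel) \<longlonglongrightarrow> (\<integral>t. f t \<partial>lborel)"
  proof (rule integral_dominated_convergence)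
    show "integrable lborel (\<lambda>t. norm (f t))" using assms by simp
    show "AE t in lborel. (\<lambda>n. indicator {- real n..real n} t *\<^sub>R f t) \<longlonglongrightarrow> f t"
    proof (rule AE_I2)
      fix t :: real
      have "eventually (\<lambda>n. indicator {- real n..real n} t *\<^sub>R f t = f t) sequentially"
        using eventually_ge_at_top[of "nat \<lceil>\<bar>t\<bar>\<rceil>"]
        by eventually_elim (auto simp: indicator_def ceiling_le_iff nat_le_iff abs_le_iff)
      then show "(\<lambda>n. indicator {- real n..real n} t *\<^sub>R f t) \<longlonglongrightarrow> f t"
        by (rule tendsto_eventually)
    qed
  qed (use assms in \<open>auto simp: indicator_def\<close>)
  moreover have "(\<integral>t. indicator {- real n..real n} t *\<^sub>R f t \<partial>lborel) = integral {- real n..real n} f" for n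
    using set_borel_integral_eq_integral(2)[of "{- real n..real n}" f]
      integrable_mult_indicator[OF _ assms, of "{- real n..real n}"]
    by (simp add: set_lebesgue_integral_def set_integrable_def)
  ultimately show ?thesis by simp
qed

text \<open>
  The parallelogram is symmetric about its centre \<open>\<i> / 2\<close>.  Each half of its boundary, from a vertex to the
  opposite one, avoids a ray from the centre along the imaginary axis, so on it \<open>1 / (w - \<i> / 2)\<close> has a
  branch of the logarithm as a primitive; each half contributes \<open>\<pi> \<i>\<close>.
\<close>

lemma winding_number_parallelogram_diag:
  fixes R :: real
  assumes "R > 0"
  defines "u \<equiv> diag * of_real R"
  defines "g \<equiv> (linepath (- u) u +++ linepath u (u + \<i>)) +++ (linepath (u + \<i>) (- u + \<i>) +++ linepath (- u + \<i>) (- u))"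
  shows "winding_number g (\<i> / 2) = 1" and "path_image g \<subseteq> {x. - 1 / 4 < Im x - Re x \<and> Im x - Re x < 5 / 4} - {\<i> / 2}"
proof -
  define v where "v = R / sqrt 2"
  have v: "v > 0" using assms by (simp add: v_def)
  have [simp]: "Re u = v" "Im u = v" by (simp_all add: u_def v_def)
  define lower where "lower = linepath (- u) u +++ linepath u (u + \<i>)"
  define upper where "upper = linepath (u + \<i>) (- u + \<i>) +++ linepath (- u + \<i>) (- u)"
  have g: "g = lower +++ upper" unfolding g_def lower_def upper_def by simp
  \<comment> \<open>Two regions, each containing one half of the boundary and omitting a vertical ray from the centre.\<close>
  define S where "S = {w. Im w - Re w < 1 / 2} \<union> {w. Re w > 0}"
  define T where "T = {w. Im w - Re w > 1 / 2} \<union> {w. Re w < 0}"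
  have cvx: "convex {w. Im w - Re w < c}" "convex {w. Im w - Re w > c}" "convex {w. Re w > d}" "convex {w. Re w < d}" for c d
  proof -
    have e: "{w. Im w - Re w < c} = {w. inner (Complex (-1) 1) w < c}"
         "{w. Im w - Re w > c} = {w. inner (Complex (-1) 1) w > c}"
      by (auto simp: inner_complex_def)
    show "convex {w. Im w - Re w < c}" "convex {w. Im w - Re w > c}"
      unfolding e by (rule convex_halfspace_lt convex_halfspace_gt)+
    show "convex {w. Re w > d}" "convex {w. Re w < d}"
      by (rule convex_halfspace_Re_gt convex_halfspace_Re_lt)+
  qed
  have "closed_segment (- u) u \<subseteq> {w. Im w - Re w < 1 / 2}" "closed_segment u (u + \<i>) \<subseteq> {w. Re w > 0}"
     "closed_segment (u + \<i>) (- u + \<i>) \<subseteq> {w. Im w - Re w > 1 / 2}" "closed_segment (- u + \<i>) (- u) \<subseteq> {w. Re w < 0}"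
    using v by (intro closed_segment_subset cvx; simp)+
  then have lS: "path_image lower \<subseteq> S" and uT: "path_image upper \<subseteq> T"
    unfolding lower_def upper_def S_def T_def by (auto simp: path_image_join)
  have vp: "valid_path lower" "valid_path upper" "valid_path g" and ends:
      "pathstart lower = - u" "pathfinish lower = u + \<i>" "pathstart upper = u + \<i>" "pathfinish upper = - u"
    unfolding g lower_def upper_def by (auto intro!: valid_path_join)
  have Snp: "\<i> * (w - \<i> / 2) \<notin> \<real>\<^sub>\<le>\<^sub>0 \<and> w \<noteq> \<i> / 2" if "w \<in> S" for w
    using that by (auto simp: S_def complex_nonpos_Reals_iff complex_eq_iff)
  have Tnp: "- \<i> * (w - \<i> / 2) \<notin> \<real>\<^sub>\<le>\<^sub>0 \<and> w \<noteq> \<i> / 2" if "w \<in> T" for w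
    using that by (auto simp: T_def complex_nonpos_Reals_iff complex_eq_iff)
  have cancel: "1 / v = inverse (c * v) * c" if "v \<noteq> 0" "c \<noteq> 0" for c v :: complex
    using that by (simp add: field_simps)
  define e where "e = \<i> * (u + \<i> / 2)"
  have "((\<lambda>w. 1 / (w - \<i> / 2)) has_contour_integral
       (Ln (\<i> * (pathfinish lower - \<i> / 2)) - Ln (\<i> * (pathstart lower - \<i> / 2)))) lower"
  proof (rule contour_integral_primitive[where S = S])
    show "((\<lambda>w. Ln (\<i> * (w - \<i> / 2))) has_field_derivative 1 / (w - \<i> / 2)) (at w within S)" if "w \<in> S" for w
    proof -
      have deriv: "((\<lambda>w. \<i> * (w - \<i> / 2)) has_field_derivative \<i>) (at w within S)"
        by (auto intro!: derivative_eq_intros)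
      have eq: "1 / v = inverse (\<i> * v) * (\<i>)" if "v \<noteq> 0" for v
        by (rule cancel[OF that]) simp
      have "w - \<i> / 2 \<noteq> 0" "\<i> * (w - \<i> / 2) \<notin> \<real>\<^sub>\<le>\<^sub>0"
        using Snp[OF that] by simp_all
      then show ?thesis
        unfolding eq[OF \<open>w - \<i> / 2 \<noteq> 0\<close>] by (intro DERIV_chain2[OF has_field_derivative_Ln deriv])
    qed
  qed (use vp lS in auto)
  then have low: "((\<lambda>w. 1 / (w - \<i> / 2)) has_contour_integral (Ln e - Ln (- e))) lower"
    unfolding ends e_def by (simp add: algebra_simps)
  have "((\<lambda>w. 1 / (w - \<i> / 2)) has_contour_integral
       (Ln (- \<i> * (pathfinish upper - \<i> / 2)) - Ln (- \<i> * (pathstart upper - \<i> / 2)))) upper"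
  proof (rule contour_integral_primitive[where S = T])
    show "((\<lambda>w. Ln (- \<i> * (w - \<i> / 2))) has_field_derivative 1 / (w - \<i> / 2)) (at w within T)" if "w \<in> T" for w
    proof -
      have deriv: "((\<lambda>w. - \<i> * (w - \<i> / 2)) has_field_derivative - \<i>) (at w within T)"
        by (auto intro!: derivative_eq_intros)
      have eq: "1 / v = inverse (- \<i> * v) * (- \<i>)" if "v \<noteq> 0" for v
        by (rule cancel[OF that]) simp
      have "w - \<i> / 2 \<noteq> 0" "- \<i> * (w - \<i> / 2) \<notin> \<real>\<^sub>\<le>\<^sub>0"
        using Tnp[OF that] by simp_all
      then show ?thesis
        unfolding eq[OF \<open>w - \<i> / 2 \<noteq> 0\<close>] by (intro DERIV_chain2[OF has_field_derivative_Ln deriv])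
    qed
  qed (use vp uT in auto)
  then have up: "((\<lambda>w. 1 / (w - \<i> / 2)) has_contour_integral (Ln e - Ln (- e))) upper"
    unfolding ends e_def by (simp add: algebra_simps)
  have "Im e > 0" using v by (simp add: e_def)
  then have "Ln (- e) = Ln e - \<i> * pi" by (subst Ln_minus) auto
  then have turn: "Ln e - Ln (- e) + (Ln e - Ln (- e)) = 2 * pi * \<i>" by simp
  have "((\<lambda>w. 1 / (w - \<i> / 2)) has_contour_integral (2 * pi * \<i>)) g"
    using has_contour_integral_join[OF low up vp(1,2)] unfolding g turn .
  moreover have "\<i> / 2 \<notin> S" "\<i> / 2 \<notin> T" using Snp Tnp by blast+
  then have avoid: "\<i> / 2 \<notin> path_image g"
    unfolding g using lS uT by (auto simp: path_image_join ends)
  ultimately have "contour_integral g (\<lambda>w. 1 / (w - \<i> / 2)) = 2 * pi * \<i>"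
    by (intro contour_integral_unique)
  then show "winding_number g (\<i> / 2) = 1"
    using winding_number_valid_path[OF vp(3) avoid] by simp
  have "convex {x. - 1 / 4 < Im x - Re x \<and> Im x - Re x < 5 / 4}"
    using convex_Int[OF cvx(2)[of "- 1 / 4"] cvx(1)[of "5 / 4"]] by (simp add: Int_def)
  then have "path_image g \<subseteq> {x. - 1 / 4 < Im x - Re x \<and> Im x - Re x < 5 / 4}"
    unfolding g_def by (simp add: path_image_join closed_segment_subset)
  then show "path_image g \<subseteq> {x. - 1 / 4 < Im x - Re x \<and> Im x - Re x < 5 / 4} - {\<i> / 2}"
    using avoid by auto
qed

text \<open>
  \<open>\<i> / 2\<close> is the only pole of the kernel in a neighbourhood of the strip between the diagonal and its
  translate by \<open>\<i>\<close>.
\<close>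

lemma cosh_zero_in_strip:
  assumes "cosh (of_real pi * x) = 0" "- 1 / 4 < Im x - Re x" "Im x - Re x < 5 / 4"
  shows "x = \<i> / 2"
proof -
  have *: "(cosh (pi * Re x))\<^sup>2 = (sin (pi * Im x))\<^sup>2"
    using norm_cosh_complex_square[of "of_real pi * x"] assms(1) by simp
  have "(sin (pi * Im x))\<^sup>2 \<le> 1" by (simp add: abs_square_le_1)
  with * have "(sinh (pi * Re x))\<^sup>2 \<le> 0"
    unfolding cosh_square_eq by linarith
  then have re: "Re x = 0" by simp
  have "(cos (pi * Im x))\<^sup>2 = 0"
    using * by (simp add: re cos_squared_eq)
  then have "sin (pi * Im x - pi / 2) = 0"
    by (simp add: sin_diff)
  moreover have "- pi < pi * Im x - pi / 2" "pi * Im x - pi / 2 < pi"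
  proof -
    have "pi * (- 1 / 4) < pi * Im x" "pi * Im x < pi * (5 / 4)"
      using assms(2,3) re by (intro mult_strict_left_mono; simp)+
    then show "- pi < pi * Im x - pi / 2" "pi * Im x - pi / 2 < pi" using pi_gt_zero by linarith+
  qed
  ultimately have "pi * Im x - pi / 2 = 0" using sin_eq_0_pi by blast
  then have "pi * (Im x - 1 / 2) = 0" by (simp add: algebra_simps)
  then show ?thesis using re by (simp add: complex_eq_iff)
qed

lemma contour_integral_mordell_kernel:
  fixes R :: real
  assumes "R > 0"
  defines "u \<equiv> diag * of_real R"
  defines "g \<equiv> (linepath (- u) u +++ linepath u (u + \<i>)) +++ (linepath (u + \<i>) (- u + \<i>) +++ linepath (- u + \<i>) (- u))"
  shows "contour_integral g (mordell_kernel \<alpha> z) = 2 * cis (- pi * \<alpha> / 4 - pi * z)"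
    and "mordell_kernel \<alpha> z contour_integrable_on g"
proof -
  define S where "S = {x. - 1 / 4 < Im x - Re x \<and> Im x - Re x < 5 / 4}"
  have S: "S = {x. inner (Complex (-1) 1) x > - 1 / 4} \<inter> {x. inner (Complex (-1) 1) x < 5 / 4}"
    by (auto simp: S_def inner_complex_def)
  have "open S" unfolding S by (intro open_Int open_halfspace_lt open_halfspace_gt)
  have "convex S" unfolding S by (intro convex_Int convex_halfspace_lt convex_halfspace_gt)
  have "\<i> / 2 \<in> S" by (simp add: S_def)
  have nz: "cosh (of_real pi * x) \<noteq> 0" if "x \<in> S - {\<i> / 2}" for x
    using that cosh_zero_in_strip[of x] by (auto simp: S_def)
  have holo_cosh: "(\<lambda>x. cosh (of_real pi * x)) holomorphic_on A" for A
    unfolding cosh_field_def by (intro holomorphic_intros) auto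
  have holo: "mordell_kernel \<alpha> z holomorphic_on S - {\<i> / 2}"
    unfolding mordell_kernel_def using nz by (intro holomorphic_intros holo_cosh) auto
  have vp: "valid_path g" unfolding g_def by (auto intro!: valid_path_join)
  have loop: "pathfinish g = pathstart g" unfolding g_def by simp
  note wn = winding_number_parallelogram_diag[OF assms(1), folded u_def, folded g_def]
  have img: "path_image g \<subseteq> S - {\<i> / 2}" using wn(2) unfolding S_def .
  show "mordell_kernel \<alpha> z contour_integrable_on g"
    using holo img vp \<open>open S\<close> by (intro contour_integrable_holomorphic_simple[of _ "S - {\<i> / 2}"]) auto
  have "contour_integral g (mordell_kernel \<alpha> z)
      = 2 * pi * \<i> * (\<Sum>p\<in>{\<i> / 2}. winding_number g p * residue (mordell_kernel \<alpha> z) p)"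
  proof (rule Residue_theorem)
    show "\<forall>w. w \<notin> S \<longrightarrow> winding_number g w = 0"
      using vp img loop \<open>convex S\<close> by (auto intro!: winding_number_zero_outside[of g S] valid_path_imp_path)
  qed (use \<open>open S\<close> \<open>convex S\<close> holo vp loop img in \<open>auto intro: convex_connected\<close>)
  also have "(\<Sum>p\<in>{\<i> / 2}. winding_number g p * residue (mordell_kernel \<alpha> z) p) = residue (mordell_kernel \<alpha> z) (\<i> / 2)"
    by (simp add: wn(1))
  also have "residue (mordell_kernel \<alpha> z) (\<i> / 2)
     = exp (\<i> * of_real (pi * \<alpha>) * (\<i> / 2)\<^sup>2 - of_real (2 * pi * z) * (\<i> / 2)) / (of_real pi * \<i>)"
    unfolding mordell_kernel_def
  proof (rule residue_simple_pole_deriv[where s = S])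
    have "sinh (of_real pi * (\<i> / 2)) = \<i>"
      by (simp add: complex_eq_iff sinh_field_def Re_exp Im_exp)
    then show "((\<lambda>x. cosh (of_real pi * x)) has_field_derivative of_real pi * \<i>) (at (\<i> / 2))"
      by (auto intro!: derivative_eq_intros simp del: times_divide_eq_right)
    show "cosh (of_real pi * (\<i> / 2)) = 0"
      by (simp add: complex_eq_iff cosh_field_def Re_exp Im_exp)
    show "(\<lambda>x. exp (\<i> * of_real (pi * \<alpha>) * x\<^sup>2 - of_real (2 * pi * z) * x)) holomorphic_on S"
      by (intro holomorphic_intros)
    show "(\<lambda>x. cosh (of_real pi * x)) holomorphic_on S" by (rule holo_cosh)
  qed (use \<open>open S\<close> \<open>convex S\<close> \<open>\<i> / 2 \<in> S\<close> in \<open>simp_all add: convex_connected\<close>)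
  also have "exp (\<i> * of_real (pi * \<alpha>) * (\<i> / 2)\<^sup>2 - of_real (2 * pi * z) * (\<i> / 2)) = cis (- pi * \<alpha> / 4 - pi * z)"
    by (simp add: cis_conv_exp power_divide algebra_simps)
  also have "of_real (2 * pi) * \<i> * (cis (- pi * \<alpha> / 4 - pi * z) / (of_real pi * \<i>)) = 2 * cis (- pi * \<alpha> / 4 - pi * z)"
    by (simp add: field_simps)
  finally show "contour_integral g (mordell_kernel \<alpha> z) = 2 * cis (- pi * \<alpha> / 4 - pi * z)" .
qed

text \<open>
  On the two short sides of the parallelogram, where \<open>x = diag * y + \<i> * \<sigma>\<close> with \<open>\<bar>y\<bar> = R\<close>, the Gaussian
  factor still decays like \<open>exp (- \<pi> \<alpha> R\<^sup>2)\<close> up to a factor exponential in \<open>R\<close>, and the denominator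
  is at least \<open>1\<close>.
\<close>

lemma norm_mordell_kernel_edge_le:
  assumes "\<alpha> > 0" "\<bar>y\<bar> = R" "R \<ge> 1" "0 \<le> \<sigma>" "\<sigma> \<le> 1"
  shows "norm (mordell_kernel \<alpha> z (diag * of_real y + \<i> * of_real \<sigma>))
           \<le> exp (- (pi * \<alpha>) * R\<^sup>2 + (sqrt 2 * pi * (\<alpha> + \<bar>z\<bar>)) * R)"
proof -
  define x where "x = diag * of_real y + \<i> * of_real \<sigma>"
  define r where "r = y / sqrt 2"
  have x: "Re x = r" "Im x = r + \<sigma>" by (simp_all add: x_def r_def)
  have y: "y = sqrt 2 * r" by (simp add: r_def)
  have "1 \<le> (pi * r)\<^sup>2"
  proof -
    have "1 \<le> y\<^sup>2" using assms(2,3) by (metis abs_ge_self abs_square_le_1 linorder_not_le one_le_power power2_abs order_trans)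
    then have "1 \<le> 2 * r\<^sup>2" by (simp add: y power_mult_distrib)
    moreover have "2 * r\<^sup>2 \<le> pi\<^sup>2 * r\<^sup>2"
      using pi_gt3 power_mono[of 3 pi 2] by (intro mult_right_mono) auto
    ultimately show ?thesis by (simp add: power_mult_distrib)
  qed
  also have "\<dots> \<le> (sinh (pi * r))\<^sup>2"
    using real_le_abs_sinh[of "pi * r"]
    by (simp add: abs_le_square_iff[symmetric] sinh_field_def exp_minus)
  also have "\<dots> \<le> (norm (cosh (of_real pi * x)))\<^sup>2"
    using sin_le_one[of "pi * Im x"] 
    by (simp add: norm_cosh_complex_square x cosh_square_eq abs_square_le_1)
  finally have c: "1 \<le> norm (cosh (of_real pi * x))"
    by (simp add: power2_le_imp_le[of 1 "norm (cosh (of_real pi * x))"])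
  have "Re (\<i> * of_real (pi * \<alpha>) * x\<^sup>2 - of_real (2 * pi * z) * x)
      = - pi * \<alpha> * (y\<^sup>2 + sqrt 2 * y * \<sigma>) + - (sqrt 2 * pi * z * y)"
    by (simp add: power2_eq_square x y algebra_simps)
  also have "\<dots> \<le> - pi * \<alpha> * (R\<^sup>2 - sqrt 2 * R) + sqrt 2 * pi * \<bar>z\<bar> * R"
  proof (rule add_mono)
    have "\<bar>y * \<sigma>\<bar> \<le> R * 1"
      unfolding abs_mult using assms by (intro mult_mono) auto
    then have "sqrt 2 * (- R) \<le> sqrt 2 * (y * \<sigma>)" by (intro mult_left_mono) auto
    moreover have "y\<^sup>2 = R\<^sup>2" using assms(2) by (metis power2_abs)
    ultimately have "R\<^sup>2 - sqrt 2 * R \<le> y\<^sup>2 + sqrt 2 * y * \<sigma>" by (simp add: mult.assoc)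
    then show "- pi * \<alpha> * (y\<^sup>2 + sqrt 2 * y * \<sigma>) \<le> - pi * \<alpha> * (R\<^sup>2 - sqrt 2 * R)"
      using assms(1) by (intro mult_left_mono_neg) auto
    show "- (sqrt 2 * pi * z * y) \<le> sqrt 2 * pi * \<bar>z\<bar> * R"
      using abs_ge_minus_self[of "sqrt 2 * pi * z * y"] by (simp add: abs_mult assms(2))
  qed
  finally have "norm (exp (\<i> * of_real (pi * \<alpha>) * x\<^sup>2 - of_real (2 * pi * z) * x))
    \<le> exp (- pi * \<alpha> * (R\<^sup>2 - sqrt 2 * R) + sqrt 2 * pi * \<bar>z\<bar> * R)"
    by (simp only: norm_exp_eq_Re exp_le_cancel_iff)
  then have "norm (mordell_kernel \<alpha> z x) \<le> exp (- pi * \<alpha> * (R\<^sup>2 - sqrt 2 * R) + sqrt 2 * pi * \<bar>z\<bar> * R) / 1"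
    unfolding mordell_kernel_def norm_divide using c by (intro frac_le) auto
  moreover have "- pi * \<alpha> * (R\<^sup>2 - sqrt 2 * R) + sqrt 2 * pi * \<bar>z\<bar> * R
      = - (pi * \<alpha>) * R\<^sup>2 + (sqrt 2 * pi * (\<alpha> + \<bar>z\<bar>)) * R"
    by (simp add: algebra_simps)
  ultimately show ?thesis by (simp only: x_def div_by_1)
qed

lemma exp_neg_quadratic_tendsto_0:
  fixes a b :: real
  assumes "a > 0"
  shows "(\<lambda>n. exp (- a * (real n)\<^sup>2 + b * real n)) \<longlonglongrightarrow> 0"
proof (rule Lim_null_comparison)
  have "eventually (\<lambda>n. (b + 1) / a \<le> real n) sequentially"
    using eventually_ge_at_top[of "nat \<lceil>(b + 1) / a\<rceil>"]
    by eventually_elim linarith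
  then show "eventually (\<lambda>n. norm (exp (- a * (real n)\<^sup>2 + b * real n)) \<le> exp (- real n)) sequentially"
  proof eventually_elim
    case (elim n)
    then have "(b + 1) * real n \<le> (a * real n) * real n"
      using assms by (intro mult_right_mono) (simp_all add: field_simps)
    then show ?case by (simp add: power2_eq_square algebra_simps)
  qed
  show "(\<lambda>n. exp (- real n)) \<longlonglongrightarrow> 0"
    by (rule filterlim_compose[OF exp_at_bot])
      (simp add: filterlim_uminus_at_top[symmetric] filterlim_real_sequentially)
qed

lemma mordell_kernel_plus_ii:
  "mordell_kernel \<alpha> z (x + \<i>) = - cis (- 2 * pi * z - pi * \<alpha>) * mordell_kernel \<alpha> (z + \<alpha>) x"
proof -
  have "cosh (of_real pi * (x + \<i>)) = - cosh (of_real pi * x)"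
  proof -
    have "exp (of_real pi * (x + \<i>)) = - exp (of_real pi * x)"
      by (simp only: distrib_left exp_add exp_pi_i' ) simp
    moreover have "exp (- (of_real pi * (x + \<i>))) = - exp (- (of_real pi * x))"
      by (simp only: distrib_left exp_add exp_pi_i minus_add_distrib exp_minus[of "of_real pi * \<i>"]) (simp add: mult.commute)
    ultimately show ?thesis by (simp only: cosh_field_def) (simp add: algebra_simps)
  qed
  moreover have "\<i> * of_real (pi * \<alpha>) * (x + \<i>)\<^sup>2 - of_real (2 * pi * z) * (x + \<i>)
      = \<i> * of_real (- 2 * pi * z - pi * \<alpha>) + (\<i> * of_real (pi * \<alpha>) * x\<^sup>2 - of_real (2 * pi * (z + \<alpha>)) * x)"
    by (simp add: power2_eq_square algebra_simps)
  ultimately show ?thesis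
    by (simp add: mordell_kernel_def exp_add cis_conv_exp)
qed

text \<open>
  By \<open>mordell_kernel_plus_ii\<close>, the left-hand side is the difference of the integrals of the kernel along the
  diagonal and along its translate by \<open>\<i>\<close>.  This is the limit of the integrals around the parallelograms, since
  the short sides contribute nothing in the limit.
\<close>

lemma mordell_integral_shift_parameter:
  assumes "\<alpha> > 0"
  shows "mordell_integral \<alpha> z + cis (- 2 * pi * z - pi * \<alpha>) * mordell_integral \<alpha> (z + \<alpha>)
       = 2 * cis (- pi * \<alpha> / 4 - pi * z)"
proof -
  define F where "F = mordell_kernel \<alpha> z"
  define u where "u n = diag * of_real (real n)" for n
  define p1 where "p1 n = linepath (- u n) (u n)" for n
  define p2 where "p2 n = linepath (u n) (u n + \<i>)" for n
  define p3 where "p3 n = linepath (u n + \<i>) (- u n + \<i>)" for n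
  define p4 where "p4 n = linepath (- u n + \<i>) (- u n)" for n
  define c where "c = cis (- 2 * pi * z - pi * \<alpha>)"
  define E where "E n = exp (- (pi * \<alpha>) * (real n)\<^sup>2 + (sqrt 2 * pi * (\<alpha> + \<bar>z\<bar>)) * real n)" for n
  have int: "F contour_integrable_on p1 n" "F contour_integrable_on p2 n"
       "F contour_integrable_on p3 n" "F contour_integrable_on p4 n"
    and total: "contour_integral (p1 n) F + contour_integral (p2 n) F + contour_integral (p3 n) F + contour_integral (p4 n) F
       = 2 * cis (- pi * \<alpha> / 4 - pi * z)" if "n > 0" for n
  proof -
    have "real n > 0" using that by simp
    note residue = contour_integral_mordell_kernel[OF this, of \<alpha> z, folded u_def p1_def p2_def p3_def p4_def F_def]
    from residue(2)
    have "F contour_integrable_on (p1 n +++ p2 n)" "F contour_integrable_on (p3 n +++ p4 n)"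
      by (simp_all add: p1_def p2_def p3_def p4_def)
    then show i: "F contour_integrable_on p1 n" "F contour_integrable_on p2 n"
       "F contour_integrable_on p3 n" "F contour_integrable_on p4 n"
      by (simp_all add: p1_def p2_def p3_def p4_def)
    show "contour_integral (p1 n) F + contour_integral (p2 n) F + contour_integral (p3 n) F + contour_integral (p4 n) F
       = 2 * cis (- pi * \<alpha> / 4 - pi * z)"
      using residue(1) i by (simp add: p1_def p2_def p3_def p4_def add.assoc)
  qed
  have edge: "norm (contour_integral (p2 n) F) \<le> E n" "norm (contour_integral (p4 n) F) \<le> E n" if "n > 0" for n
  proof -
    have "norm (F x) \<le> E n" if x: "x \<in> closed_segment (u n) (u n + \<i>)" for x
    proof -
      obtain t where t: "x = linepath (u n) (u n + \<i>) t" "t \<in> {0..1}"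
        using x unfolding linepath_image_01[symmetric] by (rule imageE)
      then have "x = diag * of_real (real n) + \<i> * of_real t"
        by (simp add: u_def linepath_def scaleR_conv_of_real algebra_simps)
      then show ?thesis
        using norm_mordell_kernel_edge_le[of \<alpha> "real n" "real n" t z] t \<open>n > 0\<close> assms by (simp add: F_def E_def)
    qed
    then have "norm (contour_integral (p2 n) F) \<le> E n * norm (u n + \<i> - u n)"
      unfolding p2_def using int(2)[OF that] by (intro contour_integral_bound_linepath) (simp_all add: p2_def E_def)
    then show "norm (contour_integral (p2 n) F) \<le> E n" by simp
    have "norm (F x) \<le> E n" if x: "x \<in> closed_segment (- u n + \<i>) (- u n)" for x
    proof -
      obtain t where t: "x = linepath (- u n + \<i>) (- u n) t" "t \<in> {0..1}"
        using x unfolding linepath_image_01[symmetric] by (rule imageE)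
      then have "x = diag * of_real (- real n) + \<i> * of_real (1 - t)"
        by (simp add: u_def linepath_def scaleR_conv_of_real algebra_simps)
      then show ?thesis
        using norm_mordell_kernel_edge_le[of \<alpha> "- real n" "real n" "1 - t" z] t \<open>n > 0\<close> assms by (simp add: F_def E_def)
    qed
    then have "norm (contour_integral (p4 n) F) \<le> E n * norm (- u n - (- u n + \<i>))"
      unfolding p4_def using int(4)[OF that] by (intro contour_integral_bound_linepath) (simp_all add: p4_def E_def)
    then show "norm (contour_integral (p4 n) F) \<le> E n" by simp
  qed
  have horizontal: "contour_integral (p1 n) F = integral {- real n..real n} (\<lambda>t. diag * F (diag * of_real t))"
      "contour_integral (p3 n) F = c * integral {- real n..real n} (\<lambda>t. diag * mordell_kernel \<alpha> (z + \<alpha>) (diag * of_real t))"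
    if "n > 0" for n
  proof -
    have "(F has_contour_integral contour_integral (p1 n) F) (linepath (diag * of_real (- real n) + 0) (diag * of_real (real n) + 0))"
      using int(1)[OF that] by (simp add: has_contour_integral_integral p1_def u_def)
    then show "contour_integral (p1 n) F = integral {- real n..real n} (\<lambda>t. diag * F (diag * of_real t))"
      using that by (subst (asm) has_contour_integral_affine_linepath) (simp, simp only: add_0_right, rule integral_unique[symmetric])
    have "(F has_contour_integral - contour_integral (p3 n) F) (reversepath (p3 n))"
      using int(3)[OF that] by (intro has_contour_integral_reversepath) (simp_all add: has_contour_integral_integral p3_def)
    then have "(F has_contour_integral - contour_integral (p3 n) F) (linepath (diag * of_real (- real n) + \<i>) (diag * of_real (real n) + \<i>))"
      by (simp add: p3_def u_def)
    then have "((\<lambda>t. diag * F (diag * of_real t + \<i>)) has_integral - contour_integral (p3 n) F) {- real n..real n}"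
      using that by (subst (asm) has_contour_integral_affine_linepath) auto
    then have "- contour_integral (p3 n) F = integral {- real n..real n} (\<lambda>t. diag * F (diag * of_real t + \<i>))"
      by (rule integral_unique[symmetric])
    also have "(\<lambda>t. diag * F (diag * of_real t + \<i>)) = (\<lambda>t. (- c) * (diag * mordell_kernel \<alpha> (z + \<alpha>) (diag * of_real t)))"
      by (simp add: F_def mordell_kernel_plus_ii c_def mult_ac)
    finally show "contour_integral (p3 n) F = c * integral {- real n..real n} (\<lambda>t. diag * mordell_kernel \<alpha> (z + \<alpha>) (diag * of_real t))"
      by simp
  qed
  have lim: "(\<lambda>n. integral {- real n..real n} (\<lambda>t. diag * mordell_kernel \<alpha> w (diag * of_real t))) \<longlonglongrightarrow> mordell_integral \<alpha> w" for w
    unfolding mordell_integral_def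
    using integral_symmetric_interval_tendsto[of "\<lambda>t. diag * mordell_kernel \<alpha> w (diag * of_real t)"]
      integrable_mordell_kernel_diag[OF assms, of w] by simp
  have E0: "E \<longlonglongrightarrow> 0" unfolding E_def using assms by (intro exp_neg_quadratic_tendsto_0) simp
  have pos: "eventually (\<lambda>n::nat. n > 0) sequentially" by (rule eventually_gt_at_top)
  have e2: "(\<lambda>n. contour_integral (p2 n) F) \<longlonglongrightarrow> 0"
    by (rule Lim_null_comparison[OF eventually_mono[OF pos edge(1)] E0])
  have e4: "(\<lambda>n. contour_integral (p4 n) F) \<longlonglongrightarrow> 0"
    by (rule Lim_null_comparison[OF eventually_mono[OF pos edge(2)] E0])
  have "(\<lambda>n. integral {- real n..real n} (\<lambda>t. diag * F (diag * of_real t)) + contour_integral (p2 n) F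
        + c * integral {- real n..real n} (\<lambda>t. diag * mordell_kernel \<alpha> (z + \<alpha>) (diag * of_real t)) + contour_integral (p4 n) F)
      \<longlonglongrightarrow> mordell_integral \<alpha> z + 0 + c * mordell_integral \<alpha> (z + \<alpha>) + 0"
    using tendsto_add[OF tendsto_add[OF tendsto_add[OF lim[of z] e2] tendsto_mult_left[OF lim[of "z + \<alpha>"]]] e4]
    unfolding F_def .
  moreover have "eventually (\<lambda>n. integral {- real n..real n} (\<lambda>t. diag * F (diag * of_real t)) + contour_integral (p2 n) F
        + c * integral {- real n..real n} (\<lambda>t. diag * mordell_kernel \<alpha> (z + \<alpha>) (diag * of_real t)) + contour_integral (p4 n) F
        = 2 * cis (- pi * \<alpha> / 4 - pi * z)) sequentially"
    using pos
  proof eventually_elim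
    case (elim n)
    show ?case using total[OF elim] unfolding horizontal[OF elim] .
  qed
  ultimately have "(\<lambda>n::nat. 2 * cis (- pi * \<alpha> / 4 - pi * z)) \<longlonglongrightarrow> mordell_integral \<alpha> z + 0 + c * mordell_integral \<alpha> (z + \<alpha>) + 0"
    by (rule Lim_transform_eventually)
  then show ?thesis unfolding LIMSEQ_const_iff c_def by simp
qed

section \<open>Reciprocity for incomplete quadratic sums\<close>

text \<open>
  The quadratic term is normalised as \<open>e(\<alpha> n\<^sup>2 / 2)\<close>, so that reciprocity exchanges \<open>\<alpha>\<close> and \<open>1 / \<alpha>\<close>.
\<close>

definition quadratic_sum :: "real \<Rightarrow> real \<Rightarrow> nat \<Rightarrow> complex" where
  "quadratic_sum \<alpha> z N = (\<Sum>n<N. cis (pi * \<alpha> * (real n)\<^sup>2 + 2 * pi * z * real n))"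

lemma neg1_power_cis: "(- 1) ^ n = cis (pi * real n)"
  by (metis Complex.DeMoivre cis_pi mult.commute)

lemma cis_cong_int:
  assumes "x - y = 2 * pi * of_int m"
  shows "cis x = cis y"
proof -
  have "cis x = cis (y + 2 * pi * of_int m)" using assms by (simp add: algebra_simps)
  also have "\<dots> = cis y" by (simp only: cis_mult[symmetric] cis_multiple_2pi[OF Ints_of_int]) simp
  finally show ?thesis .
qed

text \<open>
  The signs of the iterated equation are written as \<open>cis (\<pi> n)\<close>, so that all phases can be added.
\<close>

lemma mordell_integral_iterate_parameter:
  assumes "\<alpha> > 0"
  shows "mordell_integral \<alpha> z =
      2 * (\<Sum>n<N. cis (pi * real n - pi * \<alpha> * (real n + 1 / 2)\<^sup>2 - 2 * pi * z * (real n + 1 / 2)))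
      + cis (pi * real N - 2 * pi * z * real N - pi * \<alpha> * (real N)\<^sup>2) * mordell_integral \<alpha> (z + real N * \<alpha>)"
proof (induction N)
  case 0
  show ?case by simp
next
  case (Suc N)
  define w where "w = z + real N * \<alpha>"
  define c where "c = pi * real N - 2 * pi * z * real N - pi * \<alpha> * (real N)\<^sup>2"
  have "mordell_integral \<alpha> w = 2 * cis (- pi * \<alpha> / 4 - pi * w) + cis (pi - 2 * pi * w - pi * \<alpha>) * mordell_integral \<alpha> (w + \<alpha>)"
  proof -
    have "cis (pi - 2 * pi * w - pi * \<alpha>) = - cis (- 2 * pi * w - pi * \<alpha>)"
      by (simp add: complex_eq_iff cos_diff sin_diff cos_add sin_add)
    then show ?thesis
      using mordell_integral_shift_parameter[OF assms, of w] by (simp add: algebra_simps)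
  qed
  then have "cis c * mordell_integral \<alpha> w = 2 * cis (c + (- pi * \<alpha> / 4 - pi * w)) + cis (c + (pi - 2 * pi * w - pi * \<alpha>)) * mordell_integral \<alpha> (w + \<alpha>)"
    by (simp add: cis_mult[symmetric] distrib_left mult_ac)
  moreover have "c + (- pi * \<alpha> / 4 - pi * w) = pi * real N - pi * \<alpha> * (real N + 1 / 2)\<^sup>2 - 2 * pi * z * (real N + 1 / 2)"
    by (simp add: c_def w_def power2_eq_square field_simps)
  moreover have "c + (pi - 2 * pi * w - pi * \<alpha>) = pi * real (Suc N) - 2 * pi * z * real (Suc N) - pi * \<alpha> * (real (Suc N))\<^sup>2"
    by (simp add: c_def w_def power2_eq_square algebra_simps)
  moreover have "w + \<alpha> = z + real (Suc N) * \<alpha>"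
    by (simp add: w_def algebra_simps)
  ultimately show ?case
    using Suc.IH unfolding c_def[symmetric] w_def[symmetric] by (simp add: distrib_left)
qed

lemma mordell_integral_iterate_1:
  assumes "\<alpha> > 0"
  shows "mordell_integral \<alpha> w =
      2 * diag / sqrt \<alpha> * (\<Sum>k<K. cis (pi * real k + pi * (w + real k + 1 / 2)\<^sup>2 / \<alpha>))
      + cis (pi * real K) * mordell_integral \<alpha> (w + real K)"
proof (induction K)
  case 0
  show ?case by simp
next
  case (Suc K)
  have "mordell_integral \<alpha> (w + real K) = 2 * diag / sqrt \<alpha> * cis (pi * (w + real K + 1 / 2)\<^sup>2 / \<alpha>) - mordell_integral \<alpha> (w + real (Suc K))"
    using mordell_integral_shift_1[OF assms, of "w + real K"] by (simp add: algebra_simps)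
  then have "cis (pi * real K) * mordell_integral \<alpha> (w + real K) =
     2 * diag / sqrt \<alpha> * cis (pi * real K + pi * (w + real K + 1 / 2)\<^sup>2 / \<alpha>) - cis (pi * real K) * mordell_integral \<alpha> (w + real (Suc K))"
    by (simp add: cis_mult[symmetric] right_diff_distrib mult_ac)
  moreover have "cis (pi * real (Suc K)) = - cis (pi * real K)"
    by (simp only: neg1_power_cis[symmetric]) simp
  ultimately show ?case
    using Suc.IH by (simp add: distrib_left)
qed

text \<open>
  Completing the square identifies the sums of the two iterated equations with quadratic sums, up to
  conjugation, a constant phase and a change of \<open>z\<close>.  The start \<open>x\<close> of the first iteration may be reduced modulo
  \<open>1\<close> to \<open>[-1/2, 1/2]\<close>, and \<open>K\<close> is the integer nearest to its end point \<open>x + N \<alpha>\<close>; this explains the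
  bound for \<open>K\<close> and makes both remaining values of the integral of size \<open>\<surd>2 / \<surd>\<alpha>\<close>.
\<close>

lemma quadratic_sum_reciprocity_step:
  fixes \<alpha> z :: real and N :: nat
  assumes "\<alpha> > 0"
  obtains K z' where "real K \<le> real N * \<alpha> + 1"
    and "norm (quadratic_sum \<alpha> z N) \<le> (sqrt 2 + norm (quadratic_sum (1 / \<alpha>) z' K)) / sqrt \<alpha>"
proof -
  define y where "y = z - \<alpha> / 2 - 1 / 2"
  define x where "x = y - of_int (round y)"
  have x: "\<bar>x\<bar> \<le> 1 / 2"
    using of_int_round_abs_le[of y] by (simp add: x_def abs_minus_commute)
  define K where "K = nat (round (x + real N * \<alpha>))"
  have "real N * \<alpha> \<ge> 0" using assms by simp
  then have "0 \<le> round (x + real N * \<alpha>)"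
    using x unfolding round_def by (subst zero_le_floor) (simp add: abs_le_iff)
  then have K: "real K = of_int (round (x + real N * \<alpha>))"
    by (simp add: K_def)
  define w where "w = x + real N * \<alpha> - real K"
  have w: "\<bar>w\<bar> \<le> 1 / 2"
    using of_int_round_abs_le[of "x + real N * \<alpha>"] by (simp add: w_def K abs_minus_commute)
  define z' where "z' = (w + 1 / 2) / \<alpha> + 1 / 2"
  have "real K \<le> real N * \<alpha> + 1" using x w unfolding w_def abs_le_iff by linarith
  moreover have "norm (quadratic_sum \<alpha> z N) \<le> (sqrt 2 + norm (quadratic_sum (1 / \<alpha>) z' K)) / sqrt \<alpha>"
  proof -
    define A where "A = (\<Sum>n<N. cis (pi * real n - pi * \<alpha> * (real n + 1 / 2)\<^sup>2 - 2 * pi * x * (real n + 1 / 2)))"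
    define B where "B = (\<Sum>k<K. cis (pi * real k + pi * (w + real k + 1 / 2)\<^sup>2 / \<alpha>))"
    define d where "d = - pi * \<alpha> / 4 - pi * x"
    have "A = cis d * cnj (quadratic_sum \<alpha> z N)"
      unfolding A_def quadratic_sum_def cnj_sum sum_distrib_left
    proof (rule sum.cong, rule refl)
      fix n
      have "cis (pi * real n - pi * \<alpha> * (real n + 1 / 2)\<^sup>2 - 2 * pi * x * (real n + 1 / 2))
         = cis (d + - (pi * \<alpha> * (real n)\<^sup>2 + 2 * pi * z * real n))"
        \<comment> \<open>The sign \<open>cis (\<pi> n)\<close> and the integer \<open>round y\<close> removed from \<open>y\<close> change the phase by full turns.\<close>
        by (rule cis_cong_int[where m = "int n * (1 + round y)"])
          (simp add: d_def x_def y_def power2_eq_square field_simps)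
      then show "cis (pi * real n - pi * \<alpha> * (real n + 1 / 2)\<^sup>2 - 2 * pi * x * (real n + 1 / 2))
         = cis d * cnj (cis (pi * \<alpha> * (real n)\<^sup>2 + 2 * pi * z * real n))"
        by (simp only: cis_cnj cis_mult)
    qed
    then have A: "norm A = norm (quadratic_sum \<alpha> z N)" by (simp add: norm_mult)
    have "B = cis (pi * (w + 1 / 2)\<^sup>2 / \<alpha>) * quadratic_sum (1 / \<alpha>) z' K"
      unfolding B_def quadratic_sum_def sum_distrib_left
    proof (rule sum.cong, rule refl)
      fix k
      have "pi * real k + pi * (w + real k + 1 / 2)\<^sup>2 / \<alpha>
          = pi * (w + 1 / 2)\<^sup>2 / \<alpha> + (pi * (1 / \<alpha>) * (real k)\<^sup>2 + 2 * pi * z' * real k)"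
        using assms by (simp add: z'_def power2_eq_square field_simps)
      then show "cis (pi * real k + pi * (w + real k + 1 / 2)\<^sup>2 / \<alpha>)
          = cis (pi * (w + 1 / 2)\<^sup>2 / \<alpha>) * cis (pi * (1 / \<alpha>) * (real k)\<^sup>2 + 2 * pi * z' * real k)"
        by (simp only: cis_mult)
    qed
    then have B: "norm B = norm (quadratic_sum (1 / \<alpha>) z' K)" by (simp add: norm_mult)
    define M where "M = mordell_integral \<alpha>"
    have "2 * A = M x - cis (pi * real N - 2 * pi * x * real N - pi * \<alpha> * (real N)\<^sup>2) * M (x + real N * \<alpha>)"
      using mordell_integral_iterate_parameter[OF assms, of x N] unfolding A_def[symmetric] M_def by simp
    then have "norm (2 * A) \<le> norm (M x) + norm (cis (pi * real N - 2 * pi * x * real N - pi * \<alpha> * (real N)\<^sup>2) * M (x + real N * \<alpha>))"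
      by (simp only: norm_triangle_ineq4)
    then have 1: "2 * norm A \<le> norm (M x) + norm (M (x + real N * \<alpha>))"
      by (simp add: norm_mult)
    have "cis (pi * real K) * M (x + real N * \<alpha>) = M w - 2 * diag / sqrt \<alpha> * B"
      using mordell_integral_iterate_1[OF assms, of w K] unfolding B_def[symmetric] M_def by (simp add: w_def)
    then have "norm (cis (pi * real K) * M (x + real N * \<alpha>)) \<le> norm (M w) + norm (2 * diag / sqrt \<alpha> * B)"
      by (simp only: norm_triangle_ineq4)
    then have 2: "norm (M (x + real N * \<alpha>)) \<le> norm (M w) + 2 / sqrt \<alpha> * norm B"
      using assms by (simp add: norm_mult norm_divide)
    have "2 * norm A \<le> sqrt 2 / sqrt \<alpha> + (sqrt 2 / sqrt \<alpha> + 2 / sqrt \<alpha> * norm B)"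
      using 1 2 norm_mordell_integral_le[OF assms x] norm_mordell_integral_le[OF assms w] unfolding M_def by linarith
    then show ?thesis unfolding A[symmetric] B[symmetric] by (simp add: add_divide_distrib)
  qed
  ultimately show ?thesis by (rule that)
qed

text \<open>
  Since \<open>n\<^sup>2\<close> and \<open>n\<close> have the same parity, an integral part of \<open>\<alpha>\<close> can be moved into the linear term.
\<close>

lemma quadratic_sum_add_int:
  "quadratic_sum (\<alpha> + of_int m) z N = quadratic_sum \<alpha> (z + of_int m / 2) N"
  unfolding quadratic_sum_def
proof (rule sum.cong, rule refl)
  fix n
  have "even (int n * int n - int n)" by simp
  then obtain j where j: "int n * int n - int n = 2 * j" by (elim evenE)
  have "real n * real n - real n = 2 * of_int j"
    using arg_cong[OF j, of real_of_int] by simp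
  then have "pi * of_int m * (real n * real n - real n) = pi * of_int m * (2 * of_int j)" by simp
  then have "(pi * (\<alpha> + of_int m) * (real n)\<^sup>2 + 2 * pi * z * real n) - (pi * \<alpha> * (real n)\<^sup>2 + 2 * pi * (z + of_int m / 2) * real n)
      = 2 * pi * of_int (m * j)"
    by (simp add: power2_eq_square algebra_simps)
  then show "cis (pi * (\<alpha> + of_int m) * (real n)\<^sup>2 + 2 * pi * z * real n)
      = cis (pi * \<alpha> * (real n)\<^sup>2 + 2 * pi * (z + of_int m / 2) * real n)"
    by (rule cis_cong_int)
qed

lemma quadratic_sum_uminus: "quadratic_sum (- \<alpha>) z N = cnj (quadratic_sum \<alpha> (- z) N)"
  by (simp add: quadratic_sum_def cis_cnj)

lemma norm_quadratic_sum_le_length: "norm (quadratic_sum \<alpha> z N) \<le> real N"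
  unfolding quadratic_sum_def using norm_sum[of "\<lambda>n. cis (pi * \<alpha> * (real n)\<^sup>2 + 2 * pi * z * real n)" "{..<N}"] by simp

lemma nearest_residue:
  fixes a q :: int
  assumes "coprime a q" "q \<ge> 2"
  obtains r m where "r \<ge> 1" "2 * r \<le> q" "coprime r q" "a = r + m * q \<or> a = - r + m * q"
proof -
  define s where "s = a mod q"
  have s: "0 \<le> s" "s < q" "a = s + (a div q) * q" using assms(2) by (simp_all add: s_def)
  have cs: "coprime s q" unfolding s_def using assms by (simp add: coprime_mod_left_iff)
  then have "s \<noteq> 0" using assms(2) by auto
  show ?thesis
  proof (cases "2 * s \<le> q")
    case True
    then show ?thesis using that[of s "a div q"] s \<open>s \<noteq> 0\<close> cs by simp
  next
    case False
    have "coprime (q - s) q"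
      using cs by (metis coprime_commute coprime_diff_one_left gcd_diff2 coprime_iff_gcd_eq_1)
    moreover have "a = - (q - s) + (a div q + 1) * q" using s(3) by (simp add: algebra_simps)
    ultimately show ?thesis using that[of "q - s" "a div q + 1"] s False by simp
  qed
qed

text \<open>
  Induction along the nearest-integer continued fraction of \<open>a / q\<close>.  With \<open>\<alpha> = r / q\<close> and
  \<open>1 \<le> r \<le> q / 2\<close>, the reciprocity step gives
  \<open>(\<surd>2 + 7 \<surd>r - 5) \<surd>(q / r) = 7 \<surd>q - (5 - \<surd>2) \<surd>(q / r)\<close>,
  and \<open>(5 - \<surd>2) \<surd>2 \<ge> 5\<close>: subtracting the constant \<open>5\<close> in the claim is what absorbs the error of every step.
  The slack \<open>2\<close> in the length is stable, because \<open>(q / 2 + 2) r / q + 1 \<le> r / 2 + 2\<close>; the constant \<open>7\<close> is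
  dictated by the case \<open>q = 1\<close>, where the sum can have two terms.
\<close>

lemma incomplete_gauss_sum_bound:
  fixes a :: int and q N :: nat and z :: real
  assumes "q \<ge> 1" "coprime a (int q)" "real N \<le> real q / 2 + 2"
  shows "norm (quadratic_sum (of_int a / real q) z N) \<le> 7 * sqrt (real q) - 5"
  using assms
proof (induction q arbitrary: a N z rule: less_induct)
  case (less q)
  show ?case
  proof (cases "q = 1")
    case True
    then have "N \<le> 2" using less.prems(3) by simp
    then have "norm (quadratic_sum (of_int a / real q) z N) \<le> 2"
      using norm_quadratic_sum_le_length[of "of_int a / real q" z N] by linarith
    then show ?thesis using True by simp
  next
    case False
    then have q: "q \<ge> 2" using less.prems(1) by simp
    obtain r m where r: "r \<ge> 1" "2 * r \<le> int q" "coprime r (int q)" "a = r + m * int q \<or> a = - r + m * int q"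
      using nearest_residue[OF less.prems(2)] q by auto
    define s where "s = nat r"
    have s: "s \<ge> 1" "2 * s \<le> q" "s < q" "r = int s" using r(1,2) by (auto simp: s_def)
    define \<alpha> where "\<alpha> = real s / real q"
    have \<alpha>: "\<alpha> > 0" "\<alpha> \<le> 1 / 2" using s q by (auto simp: \<alpha>_def field_simps)
    have "of_int a / real q = \<alpha> + of_int m \<or> of_int a / real q = - \<alpha> + of_int m"
    proof -
      have "real_of_int a = real s + of_int m * real q \<or> real_of_int a = - real s + of_int m * real q"
        using r(4) by (elim disjE) (simp_all add: s(4))
      then show ?thesis using q by (elim disjE) (simp_all add: \<alpha>_def field_simps)
    qed
    then obtain y where y: "norm (quadratic_sum (of_int a / real q) z N) = norm (quadratic_sum \<alpha> y N)"
      by (metis quadratic_sum_add_int quadratic_sum_uminus complex_mod_cnj)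
    obtain K z' where K: "real K \<le> real N * \<alpha> + 1"
      "norm (quadratic_sum \<alpha> y N) \<le> (sqrt 2 + norm (quadratic_sum (1 / \<alpha>) z' K)) / sqrt \<alpha>"
      using quadratic_sum_reciprocity_step[OF \<alpha>(1)] by blast
    have "real N * \<alpha> \<le> (real q / 2 + 2) * \<alpha>"
      using less.prems(3) \<alpha>(1) by (intro mult_right_mono) auto
    also have "\<dots> = real s / 2 + 2 * \<alpha>" using q by (simp add: \<alpha>_def field_simps)
    finally have "real K \<le> real s / 2 + 2" using K(1) \<alpha>(2) by linarith
    moreover have "1 / \<alpha> = of_int (int q) / real s" by (simp add: \<alpha>_def)
    moreover have "coprime (int q) (int s)" using r(3) s(4) by (simp add: coprime_commute)
    ultimately have IH: "norm (quadratic_sum (1 / \<alpha>) z' K) \<le> 7 * sqrt (real s) - 5"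
      using less.IH[OF s(3) s(1), of "int q" K z'] by simp
    define t where "t = sqrt (real q) / sqrt (real s)"
    have "sqrt 2 \<le> t"
      using s by (simp add: t_def real_sqrt_divide[symmetric] field_simps)
    have st: "sqrt (real s) * t = sqrt (real q)" using s by (simp add: t_def)
    have sqrt2: "sqrt 2 \<ge> 7 / 5" by (rule real_le_rsqrt) (simp add: power2_eq_square)
    have "(5 - sqrt 2) * sqrt 2 \<le> (5 - sqrt 2) * t"
      using \<open>sqrt 2 \<le> t\<close> sqrt2_less_2 by (intro mult_left_mono) auto
    then have five: "5 \<le> (5 - sqrt 2) * t" using sqrt2 by (simp add: left_diff_distrib)
    have "norm (quadratic_sum \<alpha> y N) \<le> (sqrt 2 + norm (quadratic_sum (1 / \<alpha>) z' K)) * t"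
      using K(2) by (simp add: \<alpha>_def t_def real_sqrt_divide)
    also have "\<dots> \<le> (sqrt 2 + (7 * sqrt (real s) - 5)) * t"
      using IH by (intro mult_right_mono add_left_mono) (simp_all add: t_def)
    also have "\<dots> = 7 * (sqrt (real s) * t) - (5 - sqrt 2) * t" by (simp add: algebra_simps)
    also have "\<dots> \<le> 7 * sqrt (real q) - 5" unfolding st using five by linarith
    finally show ?thesis unfolding y .
  qed
qed

section \<open>The dual geometric sums\<close>

lemma norm_cis_minus_1: "norm (cis \<theta> - 1) = 2 * \<bar>sin (\<theta> / 2)\<bar>"
  using dist_exp_i_1[of \<theta>] by (simp add: cis_conv_exp)

lemma sum_cis_characters:
  fixes p :: nat and m :: int
  assumes "p > 0"
  shows "(\<Sum>b<p. cis (2 * pi * real b * of_int m / real p)) = (if int p dvd m then of_nat p else 0)"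
proof -
  define w where "w = cis (2 * pi * of_int m / real p)"
  have pow: "cis (2 * pi * real b * of_int m / real p) = w ^ b" for b
    unfolding w_def Complex.DeMoivre by (simp add: mult_ac)
  show ?thesis
  proof (cases "int p dvd m")
    case True
    then obtain j where "m = int p * j" by (elim dvdE)
    then have "w = cis 0" unfolding w_def using assms by (intro cis_cong_int[where m = j]) simp
    then show ?thesis using True by (simp add: pow)
  next
    case False
    have "w \<noteq> 1"
    proof
      assume "w = 1"
      then have "cos (2 * pi * of_int m / real p) = 1" by (simp add: w_def complex_eq_iff)
      then obtain j where "2 * pi * of_int m / real p = of_int j * 2 * pi"
        unfolding cos_one_2pi_int by auto
      then have "of_int m = real_of_int (j * int p)" using assms by (simp add: field_simps)
      then have "m = j * int p" by (simp only: of_int_eq_iff)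
      with False show False by simp
    qed
    moreover have "w ^ p = cis 0"
      unfolding w_def Complex.DeMoivre using assms by (intro cis_cong_int[where m = m]) simp
    ultimately show ?thesis using False by (simp add: pow sum_gp_strict)
  qed
qed

lemma frac_of_int_divide:
  assumes "q > 0"
  shows "frac (real_of_int n / real_of_int q) = of_int (n mod q) / of_int q"
proof -
  have "real_of_int n = of_int (n div q) * of_int q + of_int (n mod q)"
    by (metis div_mult_mod_eq of_int_add of_int_mult)
  then have "real_of_int n / real_of_int q = of_int (n div q) + of_int (n mod q) / of_int q"
    using assms by (simp add: field_simps)
  then show ?thesis by (simp add: frac_def floor_divide_of_int_eq)
qed

lemma one_over_sin_le:
  fixes x :: real
  assumes "0 < x" "x \<le> pi / 2"
  shows "1 / sin x \<le> 1 / x + 1"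
proof -
  have x2: "x \<le> 2" using assms(2) pi_less_4 by simp
  have "x * x \<le> 2 * 2" using x2 assms(1) by (intro mult_mono) auto
  then have "x / 6 + x\<^sup>2 / 6 \<le> 1" using x2 by (simp add: power2_eq_square)
  then have "x\<^sup>2 * (x / 6 + x\<^sup>2 / 6) \<le> x\<^sup>2 * 1" by (intro mult_left_mono) auto
  then have "x \<le> (x - x ^ 3 / 6) * (1 + x)"
    by (simp add: algebra_simps power2_eq_square power3_eq_cube)
  also have "\<dots> \<le> sin x * (1 + x)"
  proof (rule mult_right_mono)
    have "\<bar>sin x - x\<bar> \<le> x ^ 3 / 6"
      using Maclaurin_sin_bound[of x 3] assms(1)
      by (simp add: numeral_eq_Suc sin_coeff_def fact_numeral)
    then show "x - x ^ 3 / 6 \<le> sin x" by linarith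
  qed (use assms in simp)
  finally have "x \<le> sin x * (1 + x)" .
  moreover have "sin x > 0" using assms pi_gt_zero by (intro sin_gt_zero) auto
  ultimately show ?thesis using assms(1) by (simp add: field_simps)
qed

text \<open>
  \<open>1 / (2 n + 3) \<le> (ln (2 n + 3) - ln (2 n + 1)) / 2\<close>, by \<open>ln (1 - u) \<le> - u\<close>.
\<close>

lemma sum_odd_reciprocals_le:
  "(\<Sum>i<Suc n. 1 / (2 * real i + 1)) \<le> 1 + ln (2 * real n + 1) / 2"
proof (induction n)
  case 0
  show ?case by simp
next
  case (Suc n)
  define u where "u = 2 / (2 * real n + 3)"
  have "ln (1 - u) \<le> - u" using ln_add_one_self_le_self2[of "- u"] by (simp add: u_def)
  moreover have "1 - u = (2 * real n + 1) / (2 * real n + 3)" by (simp add: u_def field_simps)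
  ultimately have "u \<le> ln (2 * real n + 3) - ln (2 * real n + 1)" by (simp add: ln_div)
  then have "1 / (2 * real (Suc n) + 1) \<le> ln (2 * real (Suc n) + 1) / 2 - ln (2 * real n + 1) / 2"
    by (simp add: u_def algebra_simps)
  with Suc show ?case unfolding sum.lessThan_Suc[of _ "Suc n"] by linarith
qed

text \<open>
  Up to normalisation, a phase and conjugation, the Fourier coefficient at frequency \<open>b\<close> of the indicator function of any
  interval of \<open>(p - 1) / 2\<close> residues mod \<open>p\<close>.
\<close>

definition interval_sum :: "nat \<Rightarrow> nat \<Rightarrow> complex" where
  "interval_sum p b = (\<Sum>i<(p - 1) div 2. cis (2 * pi * real b * real i / real p))"

lemma norm_interval_sum_reflect:
  assumes "0 < b" "b < p"
  shows "norm (interval_sum p (p - b)) = norm (interval_sum p b)"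
proof -
  have "interval_sum p (p - b) = cnj (interval_sum p b)"
    unfolding interval_sum_def cnj_sum cis_cnj
  proof (rule sum.cong, rule refl)
    fix i
    show "cis (2 * pi * real (p - b) * real i / real p) = cis (- (2 * pi * real b * real i / real p))"
      using assms by (intro cis_cong_int[where m = "int i"]) (simp add: of_nat_diff field_simps)
  qed
  then show ?thesis by simp
qed

text \<open>
  With \<open>x = \<pi> b / (2 p)\<close> and \<open>p = 2 H + 1\<close>, the norm of the geometric sum is \<open>\<bar>sin (2 H x)\<bar> / sin (2 x)\<close>, where
  \<open>2 H x = \<pi> b / 2 - x\<close>.  For odd \<open>b\<close> the numerator is \<open>cos x\<close>.
\<close>

lemma norm_interval_sum_odd:
  assumes "odd p" "b < p" "odd b"
  shows "norm (interval_sum p b) = 1 / (2 * sin (pi * real b / (2 * real p)))"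
proof -
  define H where "H = (p - 1) div 2"
  have p: "real p = 2 * real H + 1" using assms(1) by (auto simp: H_def elim: oddE)
  define x where "x = pi * real b / (2 * real p)"
  have "b > 0" using assms(3) by (cases b) auto
  have x: "0 < x" "x < pi / 2" using assms(2) \<open>b > 0\<close> by (auto simp: x_def field_simps)
  define w where "w = cis (4 * x)"
  have pow: "cis (2 * pi * real b * real i / real p) = w ^ i" for i
    unfolding w_def Complex.DeMoivre by (simp add: x_def mult_ac)
  have sc: "sin x > 0" "cos x > 0" using x by (auto intro!: sin_gt_zero cos_gt_zero)
  have nw: "norm (w - 1) = 2 * (2 * sin x * cos x)"
    using sc sin_double[of x] by (simp add: w_def norm_cis_minus_1 abs_mult)
  then have "w \<noteq> 1" using sc by auto
  have "interval_sum p b = (\<Sum>i<H. w ^ i)" by (simp add: interval_sum_def H_def pow)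
  also have "\<dots> = (w ^ H - 1) / (w - 1)" using \<open>w \<noteq> 1\<close> by (rule geometric_sum)
  finally have "norm (interval_sum p b) = norm (w ^ H - 1) / norm (w - 1)" by (simp add: norm_divide)
  also have "norm (w ^ H - 1) = 2 * cos x"
  proof -
    obtain j where j: "b = 2 * j + 1" using assms(3) by (elim oddE)
    have "real H * (4 * x) / 2 = (real p - 1) * x" by (simp add: p)
    also have "\<dots> = (pi / 2 - x) + pi * real j"
      using p by (simp add: x_def j field_simps)
    finally have "norm (w ^ H - 1) = 2 * \<bar>sin ((pi / 2 - x) + pi * real j)\<bar>"
      unfolding w_def Complex.DeMoivre norm_cis_minus_1 by simp
    also have "\<bar>sin ((pi / 2 - x) + pi * real j)\<bar> = \<bar>sin (pi / 2 - x)\<bar>"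
      unfolding sin_add by (simp add: cos_npi2 abs_mult)
    also have "\<dots> = cos x" using sc by (simp add: sin_cos_eq[symmetric] sin_diff)
    finally show ?thesis .
  qed
  finally show ?thesis using sc nw by (simp add: x_def[symmetric])
qed

text \<open>
  The even frequencies are the reflections \<open>p - b\<close> of the odd ones, as \<open>p\<close> is odd.
\<close>

lemma sum_norm_interval_sum:
  assumes "odd p"
  shows "(\<Sum>b\<in>{1..<p}. norm (interval_sum p b)) = (\<Sum>i<(p - 1) div 2. 1 / sin (pi * real (2 * i + 1) / (2 * real p)))"
proof -
  define H where "H = (p - 1) div 2"
  have p: "p = 2 * H + 1" using assms by (auto simp: H_def elim: oddE)
  define Od where "Od = (\<lambda>i. 2 * i + 1) ` {..<H}"
  define Ev where "Ev = (\<lambda>i. p - (2 * i + 1)) ` {..<H}"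
  have "{1..<p} = Od \<union> Ev"
  proof (intro equalityI subsetI)
    fix b assume b: "b \<in> {1..<p}"
    show "b \<in> Od \<union> Ev"
    proof (cases "odd b")
      case True
      then obtain i where "b = 2 * i + 1" by (elim oddE)
      then show ?thesis using b p by (auto simp: Od_def)
    next
      case False
      then have "even b" by simp
      then obtain i where "b = 2 * i" by (elim evenE)
      then have "b = p - (2 * (H - i) + 1)" "H - i < H" using b p by auto
      then show ?thesis unfolding Ev_def by blast
    qed
  qed (auto simp: Od_def Ev_def p)
  moreover have "Od \<inter> Ev = {}"
  proof -
    have "odd b" if "b \<in> Od" for b using that by (auto simp: Od_def)
    moreover have "even b" if "b \<in> Ev" for b using that by (auto simp: Ev_def p)
    ultimately show ?thesis by auto
  qed
  ultimately have "(\<Sum>b\<in>{1..<p}. norm (interval_sum p b)) = (\<Sum>b\<in>Od. norm (interval_sum p b)) + (\<Sum>b\<in>Ev. norm (interval_sum p b))"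
    by (simp add: sum.union_disjoint Od_def Ev_def)
  also have "(\<Sum>b\<in>Od. norm (interval_sum p b)) = (\<Sum>i<H. norm (interval_sum p (2 * i + 1)))"
    unfolding Od_def by (subst sum.reindex) (auto simp: inj_on_def)
  also have "(\<Sum>b\<in>Ev. norm (interval_sum p b)) = (\<Sum>i<H. norm (interval_sum p (p - (2 * i + 1))))"
    unfolding Ev_def by (subst sum.reindex) (auto simp: inj_on_def p)
  also have "(\<Sum>i<H. norm (interval_sum p (p - (2 * i + 1)))) = (\<Sum>i<H. norm (interval_sum p (2 * i + 1)))"
    by (intro sum.cong refl norm_interval_sum_reflect) (auto simp: p)
  also have "(\<Sum>i<H. norm (interval_sum p (2 * i + 1))) = (\<Sum>i<H. 1 / (2 * sin (pi * real (2 * i + 1) / (2 * real p))))"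
    by (intro sum.cong refl norm_interval_sum_odd assms) (auto simp: p)
  finally show ?thesis unfolding H_def by (simp flip: sum.distrib)
qed

lemma sum_norm_interval_sum_le:
  assumes "odd p" "p \<ge> 3"
  shows "(\<Sum>b\<in>{1..<p}. norm (interval_sum p b)) \<le> real p * (2 / pi * (1 + ln (real p) / 2) + 1 / 2)"
proof -
  define H where "H = (p - 1) div 2"
  have p: "real p = 2 * real H + 1" using assms(1) by (auto simp: H_def elim: oddE)
  have "H \<ge> 1" using assms by (auto simp: H_def)
  then obtain n where n: "H = Suc n" by (cases H) auto
  have "(\<Sum>b\<in>{1..<p}. norm (interval_sum p b)) = (\<Sum>i<H. 1 / sin (pi * real (2 * i + 1) / (2 * real p)))"
    unfolding H_def by (rule sum_norm_interval_sum[OF assms(1)])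
  also have "\<dots> \<le> (\<Sum>i<H. 1 / (pi * real (2 * i + 1) / (2 * real p)) + 1)"
  proof (intro sum_mono one_over_sin_le)
    fix i assume "i \<in> {..<H}"
    then have "real (2 * i + 1) \<le> real p" by (simp add: p)
    then show "pi * real (2 * i + 1) / (2 * real p) \<le> pi / 2" using p by (simp add: field_simps)
  qed (use p in simp)
  also have "\<dots> = 2 * real p / pi * (\<Sum>i<Suc n. 1 / (2 * real i + 1)) + real H"
    unfolding sum.distrib sum_distrib_left n[symmetric] by (intro arg_cong2[where f = plus] sum.cong) (simp_all add: field_simps)
  also have "\<dots> \<le> 2 * real p / pi * (1 + ln (real p) / 2) + real p / 2"
  proof (intro add_mono mult_left_mono)
    have "ln (2 * real n + 1) \<le> ln (real p)" by (simp add: p n)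
    then show "(\<Sum>i<Suc n. 1 / (2 * real i + 1)) \<le> 1 + ln (real p) / 2"
      using sum_odd_reciprocals_le[of n] by linarith
  qed (use p in auto)
  finally show ?thesis by (simp add: field_simps)
qed


section \<open>Fourier expansion of the counting function\<close>

text \<open>
  Shifting \<open>k = n + 1\<close> turns the range of summation into an initial segment of the natural numbers.
\<close>

lemma f_count_eq_card_residues:
  assumes "odd p"
  defines "H \<equiv> (p - 1) div 2"
  shows "f_count \<phi> p = card {n \<in> {..<H}. int H < poly \<phi> (int n + 1) mod int p}"
proof -
  have p: "int p = 2 * int H + 1" using assms(1) by (auto simp: H_def elim: oddE)
  then have rp: "real p = 2 * real H + 1" by linarith
  have "int p > 0" using p by simp
  have frac: "frac (real_of_int m / real p) > 1 / 2 \<longleftrightarrow> int H < m mod int p" for m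
  proof -
    have "frac (real_of_int m / real p) = of_int (m mod int p) / real p"
      using frac_of_int_divide[OF \<open>int p > 0\<close>, of m] by simp
    moreover have "1 / 2 < of_int (m mod int p) / real p \<longleftrightarrow> real p < 2 * real_of_int (m mod int p)"
      using rp by (simp add: field_simps)
    moreover have "real p < 2 * real_of_int (m mod int p) \<longleftrightarrow> int p < 2 * (m mod int p)"
      by linarith
    ultimately show ?thesis using p by linarith
  qed
  have "{k::int. 1 \<le> k \<and> real_of_int k < real p / 2 \<and> frac (real_of_int (poly \<phi> k) / real p) > 1 / 2}
      = (\<lambda>n. int n + 1) ` {n \<in> {..<H}. int H < poly \<phi> (int n + 1) mod int p}"
  proof (intro equalityI subsetI)
    fix k :: int
    assume "k \<in> {k. 1 \<le> k \<and> real_of_int k < real p / 2 \<and> frac (real_of_int (poly \<phi> k) / real p) > 1 / 2}"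
    then have k: "1 \<le> k" "real_of_int k < real p / 2" "int H < poly \<phi> k mod int p"
      unfolding mem_Collect_eq frac by blast+
    from k(2) have "k \<le> int H" using rp by linarith
    then have "nat (k - 1) < H" using k(1) by linarith
    moreover have "k = int (nat (k - 1)) + 1" using k(1) by simp
    ultimately show "k \<in> (\<lambda>n. int n + 1) ` {n \<in> {..<H}. int H < poly \<phi> (int n + 1) mod int p}"
      using k(3) by (intro image_eqI[where x = "nat (k - 1)"]) auto
  next
    fix k assume "k \<in> (\<lambda>n. int n + 1) ` {n \<in> {..<H}. int H < poly \<phi> (int n + 1) mod int p}"
    then show "k \<in> {k. 1 \<le> k \<and> real_of_int k < real p / 2 \<and> frac (real_of_int (poly \<phi> k) / real p) > 1 / 2}"
      unfolding frac using rp by auto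
  qed
  then show ?thesis unfolding f_count_def by (simp add: card_image inj_on_def)
qed

definition polynomial_sum :: "int poly \<Rightarrow> nat \<Rightarrow> nat \<Rightarrow> complex" where
  "polynomial_sum \<phi> p b = (\<Sum>n<(p - 1) div 2. cis (2 * pi * real b * of_int (poly \<phi> (int n + 1)) / real p))"

text \<open>
  Both sides count the pairs of \<open>n < H\<close> and \<open>i < H\<close> with \<open>\<phi>(n + 1) mod p = H + 1 + i\<close>, each of weight \<open>p\<close>, by the
  orthogonality relation \<open>sum_cis_characters\<close>.
\<close>

lemma f_count_fourier:
  assumes "odd p"
  defines "H \<equiv> (p - 1) div 2"
  shows "of_nat p * of_nat (f_count \<phi> p) = 
    (\<Sum>b<p. polynomial_sum \<phi> p b * cis (- (2 * pi * real b * real (H + 1) / real p)) * cnj (interval_sum p b))"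
proof -
  have p: "p = 2 * H + 1" using assms(1) by (auto simp: H_def elim: oddE)
  then have "p > 0" by simp
  have ind: "(\<Sum>i<H. (\<Sum>b<p. cis (2 * pi * real b * of_int (m - int (H + 1 + i)) / real p)))
      = (if int H < m mod int p then of_nat p else 0)" for m
  proof -
    have dvd: "int p dvd m - int (H + 1 + i) \<longleftrightarrow> m mod int p = int (H + 1 + i)" if "i < H" for i
    proof -
      have "int (H + 1 + i) mod int p = int (H + 1 + i)" using that p by (intro mod_pos_pos_trivial) auto
      then show ?thesis by (metis mod_eq_dvd_iff)
    qed
    have "(\<Sum>i<H. (\<Sum>b<p. cis (2 * pi * real b * of_int (m - int (H + 1 + i)) / real p)))
        = (\<Sum>i<H. if m mod int p = int (H + 1 + i) then complex_of_nat p else 0)"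
      using \<open>p > 0\<close> by (intro sum.cong refl) (subst sum_cis_characters, simp, simp only: dvd lessThan_iff)
    also have "\<dots> = (if int H < m mod int p then of_nat p else 0)"
    proof (cases "int H < m mod int p")
      case True
      define j where "j = nat (m mod int p) - (H + 1)"
      have "m mod int p < int p" using \<open>p > 0\<close> by (intro pos_mod_bound) simp
      moreover have "int p = 2 * int H + 1" using p by simp
      ultimately have j: "j < H" "m mod int p = int (H + 1 + j)" using True unfolding j_def by linarith+
      have "(\<Sum>i<H. if m mod int p = int (H + 1 + i) then complex_of_nat p else 0)
         = (\<Sum>i<H. if i = j then complex_of_nat p else 0)"
        unfolding j(2) by (intro sum.cong) auto
      then show ?thesis using True j(1) by simp
    next
      case False
      then have "(\<Sum>i<H. if m mod int p = int (H + 1 + i) then complex_of_nat p else 0) = 0"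
        by (intro sum.neutral) auto
      then show ?thesis using False by simp
    qed
    finally show ?thesis .
  qed
  have "of_nat p * of_nat (f_count \<phi> p) = (\<Sum>n<H. if int H < poly \<phi> (int n + 1) mod int p then complex_of_nat p else 0)"
    unfolding f_count_eq_card_residues[OF assms(1)] H_def[symmetric]
    by (simp add: sum.If_cases Int_def mult.commute)
  also have "\<dots> = (\<Sum>n<H. \<Sum>i<H. \<Sum>b<p. cis (2 * pi * real b * of_int (poly \<phi> (int n + 1) - int (H + 1 + i)) / real p))"
    unfolding ind ..
  also have "\<dots> = (\<Sum>n<H. \<Sum>b<p. \<Sum>i<H. cis (2 * pi * real b * of_int (poly \<phi> (int n + 1) - int (H + 1 + i)) / real p))"
    by (intro sum.cong refl sum.swap)
  also have "\<dots> = (\<Sum>b<p. \<Sum>n<H. \<Sum>i<H. cis (2 * pi * real b * of_int (poly \<phi> (int n + 1) - int (H + 1 + i)) / real p))"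
    by (rule sum.swap)
  also have "\<dots> = (\<Sum>b<p. polynomial_sum \<phi> p b * cis (- (2 * pi * real b * real (H + 1) / real p)) * cnj (interval_sum p b))"
  proof (intro sum.cong refl)
    fix b
    have "cis (2 * pi * real b * of_int (poly \<phi> (int n + 1) - int (H + 1 + i)) / real p)
       = cis (2 * pi * real b * of_int (poly \<phi> (int n + 1)) / real p) * cis (- (2 * pi * real b * real (H + 1) / real p))
          * cis (- (2 * pi * real b * real i / real p))" for n i
      unfolding cis_mult
      by (rule arg_cong[where f = cis]) (simp add: diff_divide_distrib add_divide_distrib algebra_simps)
    then show "(\<Sum>n<H. \<Sum>i<H. cis (2 * pi * real b * of_int (poly \<phi> (int n + 1) - int (H + 1 + i)) / real p))
        = polynomial_sum \<phi> p b * cis (- (2 * pi * real b * real (H + 1) / real p)) * cnj (interval_sum p b)"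
      unfolding polynomial_sum_def interval_sum_def cnj_sum cis_cnj H_def[symmetric]
      by (simp only: sum_distrib_right[where r = "cis (- (2 * pi * real b * real (H + 1) / real p))"] sum_product)
  qed
  finally show ?thesis .
qed

text \<open>
  The leading coefficient \<open>b A\<close> enters \<open>quadratic_sum\<close> as \<open>2 b A / p\<close>, which is in lowest terms because \<open>p\<close> is odd and
  divides neither \<open>A\<close> nor \<open>b\<close>.
\<close>

lemma norm_polynomial_sum_le:
  fixes A B C :: int
  assumes "prime p" "odd p" "\<not> int p dvd A" "0 < b" "b < p"
  shows "norm (polynomial_sum [:C, B, A:] p b) \<le> 7 * sqrt (real p) - 5"
proof -
  define H where "H = (p - 1) div 2"
  have p: "p = 2 * H + 1" using assms(2) by (auto simp: H_def elim: oddE)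
  then have "p > 0" and rp: "real H \<le> real p / 2 + 2" by (simp_all add: field_simps)
  define a where "a = 2 * int b * A"
  define z where "z = real b * of_int (2 * A + B) / real p"
  define d where "d = 2 * pi * real b * of_int (A + B + C) / real p"
  have "polynomial_sum [:C, B, A:] p b = cis d * quadratic_sum (of_int a / real p) z H"
    unfolding polynomial_sum_def quadratic_sum_def sum_distrib_left H_def[symmetric]
  proof (intro sum.cong refl)
    fix n
    have "2 * pi * real b * of_int (poly [:C, B, A:] (int n + 1)) / real p
       = d + (pi * (of_int a / real p) * (real n)\<^sup>2 + 2 * pi * z * real n)"
      using \<open>p > 0\<close> by (simp add: d_def z_def a_def power2_eq_square field_simps)
    then show "cis (2 * pi * real b * of_int (poly [:C, B, A:] (int n + 1)) / real p)
       = cis d * cis (pi * (of_int a / real p) * (real n)\<^sup>2 + 2 * pi * z * real n)"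
      by (simp only: cis_mult)
  qed
  moreover have "coprime a (int p)"
  proof -
    have pr: "prime (int p)" using assms(1) by simp
    have "\<not> int p dvd 2" using assms(1,2) pr by (metis even_of_nat prime_int_iff two_is_prime_nat of_nat_numeral int_dvd_int_iff primes_dvd_imp_eq)
    moreover have "\<not> int p dvd int b" using assms(4,5) by (simp add: nat_dvd_not_less)
    ultimately have "\<not> int p dvd a" using assms(3) pr by (simp add: a_def prime_dvd_mult_iff)
    then show ?thesis using pr by (metis coprime_commute prime_imp_coprime)
  qed
  ultimately show ?thesis
    using incomplete_gauss_sum_bound[of p a H z] \<open>p > 0\<close> rp by (simp add: norm_mult)
qed

lemma f_count_error_le:
  fixes A B C :: int
  assumes "prime p" "odd p" "\<not> int p dvd A"
  shows "\<bar>real (f_count [:C, B, A:] p) - (real p - 1)\<^sup>2 / (4 * real p)\<bar>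
    \<le> (7 * sqrt (real p) - 5) * (2 / pi * (1 + ln (real p) / 2) + 1 / 2)"
proof -
  define H where "H = (p - 1) div 2"
  have p: "p = 2 * H + 1" using assms(2) by (auto simp: H_def elim: oddE)
  have "p \<ge> 3" using assms(1,2) prime_ge_2_nat[of p] by (cases "p = 2") auto
  define W where "W = 7 * sqrt (real p) - 5"
  define T where "T b = polynomial_sum [:C, B, A:] p b * cis (- (2 * pi * real b * real (H + 1) / real p)) * cnj (interval_sum p b)" for b
  have "of_nat p * of_nat (f_count [:C, B, A:] p) = (\<Sum>b<p. T b)"
    using f_count_fourier[OF assms(2)] unfolding T_def H_def .
  also have "{..<p} = insert 0 {1..<p}" using p by auto
  also have "(\<Sum>b\<in>insert 0 {1..<p}. T b) = T 0 + (\<Sum>b\<in>{1..<p}. T b)" by simp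
  also have "T 0 = of_nat (H * H)"
    by (simp add: T_def polynomial_sum_def interval_sum_def H_def)
  finally have "(\<Sum>b\<in>{1..<p}. T b) = complex_of_real (real p * real (f_count [:C, B, A:] p) - real H * real H)"
    by simp
  then have "\<bar>real p * real (f_count [:C, B, A:] p) - real H * real H\<bar> = norm (\<Sum>b\<in>{1..<p}. T b)"
    by (simp only: norm_of_real)
  also have "\<dots> \<le> (\<Sum>b\<in>{1..<p}. W * norm (interval_sum p b))"
  proof (rule sum_norm_le)
    fix b assume "b \<in> {1..<p}"
    then have "norm (polynomial_sum [:C, B, A:] p b) \<le> W"
      unfolding W_def by (intro norm_polynomial_sum_le assms) auto
    then show "norm (T b) \<le> W * norm (interval_sum p b)"
      by (simp add: T_def norm_mult mult_right_mono)
  qed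
  also have "\<dots> = W * (\<Sum>b\<in>{1..<p}. norm (interval_sum p b))" by (simp add: sum_distrib_left)
  also have "\<dots> \<le> W * (real p * (2 / pi * (1 + ln (real p) / 2) + 1 / 2))"
  proof (rule mult_left_mono[OF sum_norm_interval_sum_le[OF assms(2) \<open>p \<ge> 3\<close>]])
    have "1 \<le> sqrt (real p)" using \<open>p \<ge> 3\<close> by simp
    then show "0 \<le> W" unfolding W_def by linarith
  qed
  finally have "\<bar>real p * real (f_count [:C, B, A:] p) - real H * real H\<bar> / real p \<le> W * (2 / pi * (1 + ln (real p) / 2) + 1 / 2)"
    using p by (simp add: field_simps)
  moreover have "\<bar>real p * real (f_count [:C, B, A:] p) - real H * real H\<bar> / real p = \<bar>real (f_count [:C, B, A:] p) - (real p - 1)\<^sup>2 / (4 * real p)\<bar>"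
  proof -
    have num: "(real p - 1)\<^sup>2 = 4 * (real H * real H)" using p by (simp add: power2_eq_square)
    have "real (f_count [:C, B, A:] p) - (real p - 1)\<^sup>2 / (4 * real p) = (real p * real (f_count [:C, B, A:] p) - real H * real H) / real p"
      unfolding num using \<open>p \<ge> 3\<close> by (simp add: diff_divide_distrib)
    then show ?thesis by (simp add: abs_divide)
  qed
  ultimately show ?thesis by (simp only: W_def)
qed


section \<open>The explicit estimate\<close>

text \<open>
  The coefficient of \<open>L\<close> is \<open>1 / \<pi>\<close> on the left and the larger number \<open>4 / \<pi>\<^sup>2\<close> on the right; from \<open>L = 9\<close> on
  the difference outweighs the constant terms.
\<close>

lemma log_factor_le:
  fixes L :: real
  assumes "L \<ge> 9"
  shows "2 / pi * (1 + L / 2) + 1 / 2 \<le> 4 / pi\<^sup>2 * (ln 3 + L)"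
proof -
  have p: "pi \<le> 63 / 20" "pi > 0" using pi_approx(2) by simp_all
  have "pi\<^sup>2 \<le> (63 / 20)\<^sup>2" using p by (intro power_mono) auto
  then have p2: "pi\<^sup>2 / 2 \<le> 5" by (simp add: power2_eq_square)
  have "(4 - pi) * 9 \<le> (4 - pi) * L" using assms p by (intro mult_left_mono) auto
  then have "2 * pi + pi * L + pi\<^sup>2 / 2 \<le> 4 * (ln 3 + L)"
    using p p2 ln3_gt_1 unfolding left_diff_distrib distrib_left by linarith
  then have "(2 * pi + pi * L + pi\<^sup>2 / 2) / pi\<^sup>2 \<le> 4 * (ln 3 + L) / pi\<^sup>2"
    by (rule divide_right_mono) simp
  moreover have "(2 * pi + pi * L + pi\<^sup>2 / 2) / pi\<^sup>2 = 2 / pi * (1 + L / 2) + 1 / 2"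
    by (simp add: field_simps power2_eq_square)
  ultimately show ?thesis by simp
qed

lemma seven_mult_le: "7 * s \<le> 7.0508 * s + 2" if "0 \<le> s" for s :: real
  using that by simp

text \<open>
  Since \<open>4 / \<pi>\<^sup>2 \<ge> 2 / 5\<close>, after division by \<open>\<surd>p\<close> it suffices that \<open>\<surd>p \<le> 11 ln (3 p)\<close>.  As \<open>\<surd>p = exp (L / 2)\<close> and \<open>ln (3 p) > 1 + L\<close> for
  \<open>L = ln p\<close>, and \<open>L \<ge> 1\<close>, this is checked on the ranges \<open>L \<le> 6\<close>, \<open>6 < L \<le> 8\<close> and \<open>8 < L < 9\<close>, on each
  of which the left-hand side is taken at the right end point and the right-hand side at the left one.
\<close>

lemma quarter_le_of_ln_less_9:
  fixes p :: real
  assumes "p \<ge> 3" "ln p < 9"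
  shows "p / 4 \<le> 4 / pi\<^sup>2 * (7.0508 * sqrt p + 2) * ln (3 * p)"
proof -
  define L where "L = ln p"
  have L: "ln (3 * p) = ln 3 + L" using assms(1) by (simp add: L_def ln_mult)
  have "ln 3 \<le> L" using assms(1) by (simp add: L_def)
  then have "L \<ge> 1" using ln3_gt_1 by linarith
  have exp_le: "sqrt p \<le> (272 / 100) ^ n" if "L \<le> 2 * real n" for n
  proof -
    have "p = exp L" using assms(1) by (simp add: L_def)
    also have "\<dots> \<le> exp (2 * real n)" using that by simp
    also have "\<dots> = (exp 1 ^ n)\<^sup>2"
      by (simp add: exp_of_nat_mult[symmetric] power2_eq_square exp_add[symmetric])
    finally have "sqrt p \<le> exp 1 ^ n" by (intro real_le_lsqrt) auto
    also have "\<dots> \<le> (272 / 100) ^ n" using e_less_272 by (intro power_mono) auto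
    finally show ?thesis .
  qed
  have "sqrt p \<le> 11 * (ln 3 + L)"
  proof (cases "L \<le> 6")
    case True
    then show ?thesis using exp_le[of 3] \<open>L \<ge> 1\<close> ln3_gt_1 by (simp add: power3_eq_cube)
  next
    case False
    show ?thesis
    proof (cases "L \<le> 8")
      case True
      then show ?thesis using exp_le[of 4] False ln3_gt_1 by (simp add: power4_eq_xxxx)
    next
      case F8: False
      have "p = exp L" using assms(1) by (simp add: L_def)
      also have "\<dots> \<le> exp 9" using assms(2) by (simp add: L_def)
      also have "exp (9::real) = exp 1 ^ 9" by (simp add: exp_of_nat_mult[symmetric])
      also have "\<dots> \<le> (272 / 100) ^ 9" using e_less_272 by (intro power_mono) auto
      also have "\<dots> \<le> (99 :: real)\<^sup>2" by (simp add: power_divide)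
      finally have "sqrt p \<le> 99" by (intro real_le_lsqrt) auto
      then show ?thesis using F8 ln3_gt_1 unfolding distrib_left by linarith
    qed
  qed
  then have "sqrt p * sqrt p \<le> sqrt p * (11 * (ln 3 + L))"
    using assms(1) by (intro mult_left_mono) auto
  then have "p \<le> 11 * (sqrt p * (ln 3 + L))" using assms(1) by (simp add: algebra_simps)
  have "pi\<^sup>2 \<le> 10"
  proof -
    have "pi\<^sup>2 \<le> (63 / 20)\<^sup>2" using pi_approx(2) by (intro power_mono) auto
    then show ?thesis by (simp add: power2_eq_square)
  qed
  then have "2 / 5 \<le> 4 / pi\<^sup>2" by (simp add: field_simps)
  moreover have "7 * sqrt p \<le> 7.0508 * sqrt p + 2"
    by (rule seven_mult_le) (use assms(1) in simp)
  ultimately have "2 / 5 * ((7 * sqrt p) * (ln 3 + L)) \<le> 4 / pi\<^sup>2 * ((7.0508 * sqrt p + 2) * (ln 3 + L))"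
    using assms(1) \<open>L \<ge> 1\<close> ln3_gt_1 by (intro mult_mono mult_right_mono) auto
  have "0 \<le> sqrt p * (ln 3 + L)" using assms(1) \<open>L \<ge> 1\<close> ln3_gt_1 by simp
  have "p / 4 \<le> 2 / 5 * ((7 * sqrt p) * (ln 3 + L))" using \<open>p \<le> 11 * (sqrt p * (ln 3 + L))\<close> \<open>0 \<le> sqrt p * (ln 3 + L)\<close> by linarith
  also note \<open>2 / 5 * ((7 * sqrt p) * (ln 3 + L)) \<le> 4 / pi\<^sup>2 * ((7.0508 * sqrt p + 2) * (ln 3 + L))\<close>
  finally have "p / 4 \<le> 4 / pi\<^sup>2 * ((7.0508 * sqrt p + 2) * (ln 3 + L))" .
  then show ?thesis by (simp only: L mult.assoc)
qed

text \<open>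
  Both follow from \<open>0 \<le> f_count \<phi> p \<le> (p - 1) / 2\<close>; the second one serves for the finitely many primes that
  divide \<open>A\<close>.
\<close>

lemma f_count_trivial_bounds:
  assumes "odd p"
  shows "\<bar>real (f_count \<phi> p) - (real p - 1)\<^sup>2 / (4 * real p)\<bar> \<le> real p / 4"
    and "\<bar>real (f_count \<phi> p) - real p / 4\<bar> \<le> real p"
proof -
  define H where "H = (p - 1) div 2"
  have p: "real p = 2 * real H + 1" using assms by (auto simp: H_def elim: oddE)
  have "f_count \<phi> p \<le> card {..<H}"
    unfolding f_count_eq_card_residues[OF assms] H_def by (intro card_mono) auto
  then have f: "real (f_count \<phi> p) \<le> real p / 2 - 1 / 2" using p by (simp add: field_simps)
  have "real p \<ge> 1" using p by simp
  have main: "(real p - 1)\<^sup>2 / (4 * real p) = real p / 4 - 1 / 2 + 1 / (4 * real p)"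
    using \<open>real p \<ge> 1\<close> by (simp add: power2_eq_square field_simps)
  have "0 \<le> 1 / (4 * real p)" "1 / (4 * real p) \<le> 1 / 4" using \<open>real p \<ge> 1\<close> by (simp_all add: field_simps)
  with f main \<open>real p \<ge> 1\<close> show "\<bar>real (f_count \<phi> p) - (real p - 1)\<^sup>2 / (4 * real p)\<bar> \<le> real p / 4"
    unfolding abs_le_iff by (intro conjI; linarith)
  show "\<bar>real (f_count \<phi> p) - real p / 4\<bar> \<le> real p"
    using f \<open>real p \<ge> 1\<close> unfolding abs_le_iff by (intro conjI; linarith)
qed

lemma f_count_quadratic_explicit:
  fixes A B C :: int
  assumes "prime p" "odd p" "\<not> int p dvd A"
  shows "\<bar>real (f_count [:C, B, A:] p) - (real p - 1)\<^sup>2 / (4 * real p)\<bar>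
             \<le> 4 / pi\<^sup>2 * (7.0508 * sqrt (real p) + 2) * ln (3 * real p)"
proof -
  have "p \<ge> 3" using assms(1,2) prime_ge_2_nat[of p] by (cases "p = 2") auto
  show ?thesis
  proof (cases "ln (real p) < 9")
    case True
    then show ?thesis
      using \<open>p \<ge> 3\<close> by (intro order_trans[OF f_count_trivial_bounds(1)[OF assms(2)] quarter_le_of_ln_less_9]) simp_all
  next
    case False
    have ln3p: "ln (3 * real p) = ln 3 + ln (real p)" using \<open>p \<ge> 3\<close> by (simp add: ln_mult)
    have "\<bar>real (f_count [:C, B, A:] p) - (real p - 1)\<^sup>2 / (4 * real p)\<bar>
      \<le> (7 * sqrt (real p) - 5) * (2 / pi * (1 + ln (real p) / 2) + 1 / 2)"
      by (rule f_count_error_le[OF assms])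
    also have "\<dots> \<le> (7.0508 * sqrt (real p) + 2) * (4 / pi\<^sup>2 * ln (3 * real p))"
    proof (rule mult_mono)
      show "2 / pi * (1 + ln (real p) / 2) + 1 / 2 \<le> 4 / pi\<^sup>2 * ln (3 * real p)"
        unfolding ln3p using False by (intro log_factor_le) simp
      have "7 * sqrt (real p) \<le> 7.0508 * sqrt (real p) + 2" by (rule seven_mult_le) simp
      then show "7 * sqrt (real p) - 5 \<le> 7.0508 * sqrt (real p) + 2" by linarith
      have "0 \<le> ln (real p)" using \<open>p \<ge> 3\<close> by simp
      then show "0 \<le> 2 / pi * (1 + ln (real p) / 2) + 1 / 2" by simp
    qed simp
    finally show ?thesis by (simp only: mult_ac)
  qed
qed

theorem theorem1p3:
  fixes A B C :: int and \<phi> :: "int poly"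
  assumes "A \<noteq> 0" and "\<phi> = [:C, B, A:]"
  shows "(\<forall>p::nat. prime p \<and> odd p \<and> \<not> int p dvd A \<longrightarrow>
           \<bar>real (f_count \<phi> p) - (real p - 1)\<^sup>2 / (4 * real p)\<bar>
             \<le> 4 / pi\<^sup>2 * (7.0508 * sqrt (real p) + 2) * ln (3 * real p)) \<and>
         (\<exists>c::real. c > 0 \<and> (\<forall>p::nat. prime p \<and> odd p \<longrightarrow>
           \<bar>real (f_count \<phi> p) - real p / 4\<bar> \<le> c * (sqrt (real p) * ln (real p))))"
proof (intro conjI allI impI exI)
  show "\<bar>real (f_count \<phi> p) - (real p - 1)\<^sup>2 / (4 * real p)\<bar>
             \<le> 4 / pi\<^sup>2 * (7.0508 * sqrt (real p) + 2) * ln (3 * real p)"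
    if "prime p \<and> odd p \<and> \<not> int p dvd A" for p
    unfolding assms(2) using that by (intro f_count_quadratic_explicit) auto
  \<comment> \<open>The summand \<open>\<bar>A\<bar>\<close> takes care of the primes \<open>p\<close> dividing \<open>A\<close>, which satisfy \<open>p \<le> \<bar>A\<bar>\<close>.\<close>
  show "0 < 10 + \<bar>real_of_int A\<bar>" by simp
  show "\<bar>real (f_count \<phi> p) - real p / 4\<bar> \<le> (10 + \<bar>real_of_int A\<bar>) * (sqrt (real p) * ln (real p))"
    if "prime p \<and> odd p" for p
  proof -
    have "p \<ge> 3" using that prime_ge_2_nat[of p] by (cases "p = 2") auto
    define s l where "s = sqrt (real p)" and "l = ln (real p)"
    have s: "s \<ge> 1" using \<open>p \<ge> 3\<close> by (simp add: s_def)
    have "ln 3 \<le> l" using \<open>p \<ge> 3\<close> by (simp add: l_def)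
    then have l: "l \<ge> 1" using ln3_gt_1 by linarith
    have sl: "1 \<le> s * l" using mult_mono[OF s l] s by simp
    show ?thesis
    proof (cases "int p dvd A")
      case True
      then have "int p \<le> \<bar>A\<bar>" using zdvd_imp_le[of "int p" "\<bar>A\<bar>"] assms(1) by simp
      then have "real p \<le> \<bar>real_of_int A\<bar>" by linarith
      also have "\<dots> \<le> (10 + \<bar>real_of_int A\<bar>) * (s * l)"
        using mult_mono[of "\<bar>real_of_int A\<bar>" "10 + \<bar>real_of_int A\<bar>" 1 "s * l"] sl by simp
      finally show ?thesis using f_count_trivial_bounds(2)[of p \<phi>] that unfolding s_def l_def by linarith
    next
      case False
      have "\<bar>real (f_count \<phi> p) - (real p - 1)\<^sup>2 / (4 * real p)\<bar> \<le> 4 / pi\<^sup>2 * (7.0508 * s + 2) * ln (3 * real p)"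
        unfolding assms(2) s_def using that False by (intro f_count_quadratic_explicit) auto
      also have "\<dots> \<le> 4 / 9 * (10 * s) * (2 * l)"
      proof (intro mult_mono)
        have "3\<^sup>2 \<le> pi\<^sup>2" using pi_gt3 by (intro power_mono) auto
        then show "4 / pi\<^sup>2 \<le> 4 / 9" by (intro divide_left_mono) auto
        show "7.0508 * s + 2 \<le> 10 * s" using s by simp
        show "ln (3 * real p) \<le> 2 * l"
          using \<open>p \<ge> 3\<close> \<open>ln 3 \<le> l\<close> by (simp add: ln_mult l_def)
      qed (use s l \<open>p \<ge> 3\<close> in auto)
      also have "4 / 9 * (10 * s) * (2 * l) = 80 / 9 * (s * l)" by simp
      also have "\<dots> \<le> 9 * (s * l)" using sl by (intro mult_right_mono) auto
      finally have 1: "\<bar>real (f_count \<phi> p) - (real p - 1)\<^sup>2 / (4 * real p)\<bar> \<le> 9 * (s * l)" .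
      have "(real p - 1)\<^sup>2 / (4 * real p) = real p / 4 - 1 / 2 + 1 / (4 * real p)"
        using \<open>p \<ge> 3\<close> by (simp add: power2_eq_square field_simps)
      moreover have "0 \<le> 1 / (4 * real p)" "1 / (4 * real p) \<le> 1 / 2" using \<open>p \<ge> 3\<close> by (simp_all add: field_simps)
      ultimately have "\<bar>real (f_count \<phi> p) - real p / 4\<bar> \<le> 9 * (s * l) + 1" using 1 by linarith
      also have "\<dots> \<le> (10 + \<bar>real_of_int A\<bar>) * (s * l)"
      proof -
        have "0 \<le> \<bar>real_of_int A\<bar> * (s * l)" using s l by simp
        then show ?thesis using sl unfolding distrib_right by linarith
      qed
      finally show ?thesis unfolding s_def l_def .
    qed
  qed
qed

end
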